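(* Suppose $q$ is a prime power and $a,b,c,d\in\mathbb{F}_{q^2}$. Write $f(X):=aX^{3q} + bX^{2q+1} + cX^{q+2} + d X^3 \in \mathbb{F}_{q^2}[X]$. Then $f(X)$ permutes $\mathbb{F}_{q^2}$ if and only if (the function induced by) $f(X)$ is $\mathbb{F}_q$-linearly equivalent to one of the following: (1) $X^{q+2}$ (as a map on $\mathbb{F}_{q^2}$), where $q\not\equiv 1\pmod 3$; (2) $(X^3,Y^3)$ (as a map on $\mathbb{F}_q\times\mathbb{F}_q$), where $q\not\equiv 1\pmod 3$; (3) $(X^3-eXY^2,Y^3)$ (as a map on $\mathbb{F}_q\times\mathbb{F}_q$) for some nonsquare $e\in\mathbb{F}_q^*$, where $q\equiv 0\pmod 3$.
   Context: If $U$ and $V$ are $\mathbb{F}_q$-vector spaces, a function $f\colon U\to U$ is $\mathbb{F}_q$-linearly equivalent to a function $g\colon V\to V$ if $f=\rho\circ g\circ\eta^{-1}$ for some $\mathbb{F}_q$-vector space isomorphisms $\rho$ and $\eta$ from $V$ to $U$. Here $\mathbb{F}_{q^2}$ and $\mathbb{F}_q\times\mathbb{F}_q$ are viewed as $\mathbb{F}_q$-vector spaces. *)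

theory Defs
  imports "HOL-Computational_Algebra.Primes"
begin

text \<open>The subfield F_q of a finite field 'a of order q^2: the fixed points of x \<mapsto> x^q.\<close>
definition Fq :: "nat \<Rightarrow> 'a::field set" where
  "Fq q = {x. x ^ q = x}"

definition Fq_lin_iso :: "nat \<Rightarrow> ('a::field \<Rightarrow> 'a) \<Rightarrow> bool" where
  "Fq_lin_iso q \<rho> \<longleftrightarrow> bij \<rho>
     \<and> (\<forall>x y. \<rho> (x + y) = \<rho> x + \<rho> y)
     \<and> (\<forall>c\<in>Fq q. \<forall>x. \<rho> (c * x) = c * \<rho> x)"

definition Fq_lin_iso_pair :: "nat \<Rightarrow> ('a::field \<times> 'a \<Rightarrow> 'a) \<Rightarrow> bool" where
  "Fq_lin_iso_pair q \<rho> \<longleftrightarrow> bij_betw \<rho> (Fq q \<times> Fq q) UNIV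
     \<and> (\<forall>v\<in>Fq q \<times> Fq q. \<forall>w\<in>Fq q \<times> Fq q.
          \<rho> (fst v + fst w, snd v + snd w) = \<rho> v + \<rho> w)
     \<and> (\<forall>c\<in>Fq q. \<forall>v\<in>Fq q \<times> Fq q. \<rho> (c * fst v, c * snd v) = c * \<rho> v)"

definition lin_equiv_self :: "nat \<Rightarrow> ('a::field \<Rightarrow> 'a) \<Rightarrow> ('a \<Rightarrow> 'a) \<Rightarrow> bool" where
  "lin_equiv_self q f g \<longleftrightarrow> (\<exists>\<rho> \<eta>. Fq_lin_iso q \<rho> \<and> Fq_lin_iso q \<eta>
      \<and> (\<forall>u. f u = \<rho> (g (inv \<eta> u))))"

definition lin_equiv_pair :: "nat \<Rightarrow> ('a::field \<Rightarrow> 'a) \<Rightarrow> ('a \<times> 'a \<Rightarrow> 'a \<times> 'a) \<Rightarrow> bool" where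
  "lin_equiv_pair q f g \<longleftrightarrow> (\<exists>\<rho> \<eta>. Fq_lin_iso_pair q \<rho> \<and> Fq_lin_iso_pair q \<eta>
      \<and> (\<forall>u. f u = \<rho> (g (inv_into (Fq q \<times> Fq q) \<eta> u))))"

end

theory Submission
  imports Defs "HOL-Computational_Algebra.Polynomial"
begin

text \<open>
  Write \<open>K\<close> for the field of \<open>q\<close> elements and \<open>x'\<close> for \<open>x\<^sup>q\<close>. The map \<open>f\<close> is a pair of binary cubic
  forms over \<open>K\<close>, so a cube root of unity in \<open>K\<close> prevents injectivity, and otherwise bijectivity of
  \<open>f\<close> means that each form in the pencil has exactly one zero in the projective line over \<open>K\<close>.
  Take one such form. Either it is a multiple of the cube of a linear form, or, in a suitable
  coordinate \<open>x\<close> on the quadratic extension, it is a multiple of \<open>x x' (x + x')\<close>. In the first case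
  \<open>f\<close> amounts to a cubic polynomial permuting \<open>K\<close>, and Hermite's criterion gives (2) or (3).
  In the second case let \<open>r x\<^sup>3 + s x\<^sup>2 x' + s' x x'\<^sup>2 + r' x'\<^sup>3\<close> be the other form of the pair.
  The power sums of the products \<open>g\<^sup>i h\<^sup>j\<close> of the two forms with \<open>i + j = q - 1\<close> vanish; for
  \<open>j \<le> 3\<close> this says \<open>r' = - r\<close> and \<open>r = 0\<close> or \<open>s - s' = 3 r\<close>. If \<open>r = 0\<close>, then \<open>x x'\<close> is a common
  factor and (1) holds; otherwise the pencil contains \<open>r (x - \<omega> x')\<^sup>3\<close> with \<open>\<omega>\<^sup>2 + \<omega> + 1 = 0\<close>, which
  is the first case again.
\<close>

section \<open>Finite fields and power sums\<close>

lemma card_nth_root_le: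
  fixes c :: "'a::idom"
  assumes "n > 0"
  shows "card {x. x ^ n = c} \<le> n"
proof -
  have "degree (monom 1 n - [:c:]) = n"
    using assms by (intro antisym degree_diff_le le_degree)
      (auto simp: degree_monom_eq coeff_pCons split: nat.splits)
  moreover from this have "monom 1 n - [:c:] \<noteq> 0"
    using assms by auto
  ultimately show ?thesis
    using card_poly_roots_bound[of "monom 1 n - [:c:]"] by (simp add: poly_monom)
qed

lemma card_le_mult_card_image:
  assumes "finite A" and "\<And>y. y \<in> h ` A \<Longrightarrow> card {x\<in>A. h x = y} \<le> k"
  shows "card A \<le> k * card (h ` A)"
proof -
  have "card A = (\<Sum>x\<in>A. 1)" by simp
  also have "\<dots> = (\<Sum>y\<in>h ` A. \<Sum>x\<in>{x\<in>A. h x = y}. 1)"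
    using assms(1) by (rule sum.image_gen)
  also have "\<dots> = (\<Sum>y\<in>h ` A. card {x\<in>A. h x = y})" by simp
  also have "\<dots> \<le> (\<Sum>y\<in>h ` A. k)"
    using assms(2) by (rule sum_mono)
  finally show ?thesis by (simp add: mult.commute)
qed

text \<open>Multiplication by a nonzero \<open>x\<close> permutes the nonzero elements; comparing
  their products gives Fermat's identity.\<close>

lemma finite_field_power_card:
  fixes x :: "'a::{field,finite}"
  shows "x ^ card (UNIV :: 'a set) = x"
proof (cases "x = 0")
  case False
  have "(\<Prod>y\<in>UNIV-{0}. x * y) = (\<Prod>y\<in>UNIV-{0}. y)"
    by (rule prod.reindex_bij_witness[of _ "\<lambda>y. y / x" "\<lambda>y. x * y"]) (use False in auto)
  then have "x ^ (card (UNIV :: 'a set) - 1) = 1"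
    by (simp add: prod.distrib)
  then show ?thesis
    using power_minus_mult[of "card (UNIV :: 'a set)" x] by (simp add: finite_UNIV_card_ge_0)
qed (simp add: finite_UNIV_card_ge_0)

text \<open>At most \<open>m\<close> elements satisfy \<open>x ^ m = 1\<close>, so some nonzero
  \<open>g\<close> in \<open>S\<close> has \<open>g ^ m \<noteq> 1\<close>, and replacing
  \<open>x\<close> by \<open>g * x\<close> multiplies the sum by \<open>g ^ m\<close>. The closure
  conditions fit both \<open>K\<close> and the whole field.\<close>

lemma sum_power_subfield_eq_0:
  fixes S :: "'a::{field,finite} set"
  assumes S: "\<And>x y. x \<in> S \<Longrightarrow> y \<in> S \<Longrightarrow> x * y \<in> S"
      "\<And>x. x \<in> S \<Longrightarrow> inverse x \<in> S"
    and m: "0 < m" "m < card S - 1"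
  shows "(\<Sum>x\<in>S. x ^ m) = 0"
proof -
  have "\<exists>g\<in>S - {0}. g ^ m \<noteq> 1"
  proof (rule ccontr)
    assume "\<not> ?thesis"
    then have "S - {0} \<subseteq> {x. x ^ m = 1}" by auto
    then have "card (S - {0}) \<le> m"
      by (intro order_trans[OF card_mono card_nth_root_le[OF m(1)]]) auto
    moreover have "card S - 1 \<le> card (S - {0})"
      using diff_card_le_card_Diff[of "{0}" S] by simp
    ultimately show False using m by simp
  qed
  then obtain g where g: "g \<in> S" "g \<noteq> 0" "g ^ m \<noteq> 1" by auto
  have "(\<Sum>x\<in>S. x ^ m) = (\<Sum>x\<in>S. (g * x) ^ m)"
    by (rule sum.reindex_bij_witness[of _ "\<lambda>x. g * x" "\<lambda>x. inverse g * x"])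
       (use g S in \<open>auto simp: mult.assoc[symmetric]\<close>)
  also have "\<dots> = g ^ m * (\<Sum>x\<in>S. x ^ m)"
    by (simp add: power_mult_distrib sum_distrib_left)
  finally show ?thesis using g(3) by auto
qed

section \<open>The field of \<open>q ^ 2\<close> elements, its conjugation and its fixed
  field\<close>

locale quadratic_extension =
  fixes q :: nat and field_type :: "'a::{field,finite} itself"
  assumes prime_power: "\<exists>p k. prime p \<and> k > 0 \<and> q = p ^ k"
    and card_UNIV: "card (UNIV :: 'a set) = q ^ 2"
begin

abbreviation K :: "'a set" where "K \<equiv> Fq q"

text \<open>The nontrivial automorphism over \<open>K\<close>; with it the polynomial of the theorem
  becomes a binary cubic form in \<open>x\<close> and \<open>cnj x\<close>.\<close>

definition cnj :: "'a \<Rightarrow> 'a" where "cnj x = x ^ q"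

lemma q_ge_2: "q \<ge> 2"
proof -
  obtain p k where "prime p" "k > 0" "q = p ^ k" using prime_power by blast
  then show ?thesis
    by (metis One_nat_def Suc_leI le_trans power_increasing power_one_right prime_ge_1_nat prime_ge_2_nat)
qed

text \<open>Translation by 1 permutes the field, so comparing sums of all elements gives
  \<open>q ^ 2 = 0\<close> there, and the characteristic must be the prime dividing
  \<open>q\<close>.\<close>

lemma q_eq_CHAR_power: "\<exists>k>0. prime CHAR('a) \<and> q = CHAR('a) ^ k"
proof -
  obtain p k where pk: "prime p" "k > 0" "q = p ^ k" using prime_power by blast
  have "(\<Sum>x\<in>(UNIV::'a set). x) = (\<Sum>x\<in>UNIV. x + 1)"
    by (rule sum.reindex_bij_witness[of _ "\<lambda>x. x + 1" "\<lambda>x. x - 1"]) auto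
  also have "\<dots> = (\<Sum>x\<in>UNIV. x) + of_nat (q ^ 2)"
    by (simp add: sum.distrib card_UNIV)
  finally have "of_nat (q ^ 2) = (0 :: 'a)" by simp
  then have dvd: "CHAR('a) dvd (p ^ k) ^ 2" using of_nat_eq_0_iff_char_dvd pk by blast
  have "CHAR('a) > 0" by (rule finite_imp_CHAR_pos) simp
  then have pr: "prime CHAR('a)" using prime_CHAR_semidom by blast
  with dvd have "CHAR('a) dvd p" using prime_dvd_power by blast
  then have "CHAR('a) = p" using pr pk primes_dvd_imp_eq by blast
  then show ?thesis using pk by blast
qed

lemma of_nat_q [simp]: "of_nat q = (0 :: 'a)"
  using q_eq_CHAR_power by (auto simp: of_nat_eq_0_iff_char_dvd)

lemma of_nat_eq_0_iff_prime: "prime r \<Longrightarrow> of_nat r = (0::'a) \<longleftrightarrow> r dvd q"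
proof -
  assume r: "prime r"
  obtain k where k: "k > 0" "prime CHAR('a)" "q = CHAR('a) ^ k" using q_eq_CHAR_power by blast
  then have "r dvd q \<longleftrightarrow> r = CHAR('a)"
    using r primes_dvd_imp_eq prime_dvd_power[of r "CHAR('a)" k] by auto
  then show ?thesis
    using k r primes_dvd_imp_eq[of "CHAR('a)" r] by (auto simp: of_nat_eq_0_iff_char_dvd)
qed

lemma cnj_add [simp]: "cnj (x + y) = cnj x + cnj y"
  using q_eq_CHAR_power freshmans_dream' unfolding cnj_def by blast

lemma cnj_mult [simp]: "cnj (x * y) = cnj x * cnj y"
  and cnj_inverse [simp]: "cnj (inverse x) = inverse (cnj x)"
  and cnj_divide [simp]: "cnj (x / y) = cnj x / cnj y"
  and cnj_0 [simp]: "cnj 0 = 0"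
  and cnj_1 [simp]: "cnj 1 = 1"
  using q_ge_2
  by (auto simp: cnj_def power_mult_distrib power_inverse power_divide)

lemma cnj_power [simp]: "cnj (x ^ n) = cnj x ^ n"
  by (induction n) auto

lemma cnj_minus [simp]: "cnj (- x) = - cnj x"
  using cnj_add[of x "- x"] by (simp add: eq_neg_iff_add_eq_0 add.commute)

lemma cnj_diff [simp]: "cnj (x - y) = cnj x - cnj y"
  using cnj_add[of x "- y"] by simp

lemma cnj_numeral [simp]: "cnj (numeral n) = numeral n"
proof -
  have "cnj (of_nat m) = of_nat m" for m by (induction m) auto
  from this[of "numeral n"] show ?thesis by simp
qed

lemma cnj_cnj [simp]: "cnj (cnj x) = x"
  using finite_field_power_card[of x]
  by (simp add: cnj_def card_UNIV power2_eq_square flip: power_mult)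

lemma cnj_eq_iff [simp]: "cnj x = cnj y \<longleftrightarrow> x = y"
  by (metis cnj_cnj)

lemma cnj_eq_0_iff [simp]: "cnj x = 0 \<longleftrightarrow> x = 0"
  by (metis cnj_cnj cnj_0)

lemma K_iff: "x \<in> K \<longleftrightarrow> cnj x = x"
  by (simp add: Fq_def cnj_def)

lemma K_D: "x \<in> K \<Longrightarrow> cnj x = x"
  by (simp add: K_iff)

lemma K_closed [intro]:
  "0 \<in> K" "1 \<in> K" "x \<in> K \<Longrightarrow> - x \<in> K" "x \<in> K \<Longrightarrow> y \<in> K \<Longrightarrow> x + y \<in> K"
  "x \<in> K \<Longrightarrow> y \<in> K \<Longrightarrow> x - y \<in> K" "x \<in> K \<Longrightarrow> y \<in> K \<Longrightarrow> x * y \<in> K"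
  "x \<in> K \<Longrightarrow> y \<in> K \<Longrightarrow> x / y \<in> K" "x \<in> K \<Longrightarrow> x ^ n \<in> K" "x \<in> K \<Longrightarrow> inverse x \<in> K"
  "numeral k \<in> K"
  by (simp_all add: K_iff)

lemma trace_in_K [intro]: "x + cnj x \<in> K" and norm_in_K [intro]: "x * cnj x \<in> K"
  by (simp_all add: K_iff ac_simps)

lemma card_K: "card K = q"
proof (rule antisym)
  have "{x. poly (monom 1 q - [:0, 1::'a:]) x = 0} = K"
    by (simp add: poly_monom Fq_def)
  moreover have "degree (monom 1 q - [:0, 1::'a:]) = q"
    using q_ge_2 by (intro antisym degree_diff_le le_degree)
      (auto simp: degree_monom_eq coeff_pCons split: nat.splits)
  moreover from this have "monom 1 q - [:0, 1::'a:] \<noteq> 0"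
    using q_ge_2 by auto
  ultimately show "card K \<le> q"
    using card_poly_roots_bound[of "monom 1 q - [:0, 1::'a:]"] by simp
next
  \<comment> \<open>The trace maps into K and its fibres are translates of the zero set of \<open>X\<^sup>q + X\<close>.\<close>
  have "card (UNIV :: 'a set) \<le> q * card (range (\<lambda>x. x + cnj x))"
  proof (rule card_le_mult_card_image)
    fix y
    have "{x. poly (monom 1 q + [:- y, 1::'a:]) x = 0} = {x \<in> UNIV. x + cnj x = y}"
      by (auto simp: poly_monom cnj_def algebra_simps)
    moreover have "degree (monom 1 q + [:- y, 1::'a:]) = q"
      using q_ge_2 by (intro antisym degree_add_le le_degree)
        (auto simp: degree_monom_eq coeff_pCons split: nat.splits)
    moreover from this have "monom 1 q + [:- y, 1::'a:] \<noteq> 0"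
      using q_ge_2 by auto
    ultimately show "card {x \<in> UNIV. x + cnj x = y} \<le> q"
      using card_poly_roots_bound[of "monom 1 q + [:- y, 1::'a:]"] by simp
  qed simp
  also have "card (range (\<lambda>x. x + cnj x)) \<le> card K"
    by (intro card_mono) auto
  finally show "q \<le> card K"
    using q_ge_2 by (simp add: card_UNIV power2_eq_square)
qed

lemma ex_not_in_K: "\<exists>x. x \<notin> K"
proof (rule ccontr)
  assume "\<not> ?thesis"
  then have "K = UNIV" by auto
  then show False using card_K card_UNIV q_ge_2 by (simp add: power2_eq_square)
qed

text \<open>Exponent 0 is included: as \<open>0 ^ 0 = 1\<close>, the sum is then \<open>q\<close>,
  which is zero in the field.\<close>

lemma sum_power_K_eq_0: "m < q - 1 \<Longrightarrow> (\<Sum>x\<in>K. x ^ m) = 0"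
  using sum_power_subfield_eq_0[of K m] by (cases "m = 0") (auto simp: card_K)

text \<open>On nonzero elements exponents count modulo \<open>q ^ 2 - 1\<close>. Exponent 0 there
  contributes 1 for each of the \<open>q ^ 2 - 1\<close> nonzero elements, in total -1; any other
  residue gives a vanishing sum.\<close>

lemma sum_power_UNIV:
  assumes "m > 0"
  shows "(\<Sum>x\<in>(UNIV::'a set). x ^ m) = (if q ^ 2 - 1 dvd m then - 1 else 0)"
proof -
  let ?N = "q ^ 2 - 1"
  have q2: "q ^ 2 \<ge> 4" using power_mono[OF q_ge_2, of 2] by simp
  have one: "x ^ ?N = 1" if "x \<noteq> 0" for x :: 'a
    using finite_field_power_card[of x] power_minus_mult[of "q ^ 2" x] that q2 q_ge_2
    by (simp add: card_UNIV)
  have red: "x ^ m = x ^ (m mod ?N)" if "x \<noteq> 0" for x :: 'a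
  proof -
    have "x ^ m = (x ^ ?N) ^ (m div ?N) * x ^ (m mod ?N)"
      by (simp flip: power_mult power_add)
    then show ?thesis using one[OF that] by simp
  qed
  show ?thesis
  proof (cases "m mod ?N = 0")
    case True
    have "(\<Sum>x\<in>(UNIV::'a set). x ^ m) = (\<Sum>x\<in>UNIV - {0::'a}. x ^ m)"
      using assms by (intro sum.mono_neutral_right) auto
    also have "\<dots> = (\<Sum>x\<in>UNIV - {0::'a}. 1)"
      using red True by (intro sum.cong) auto
    also have "\<dots> = of_nat (q ^ 2) - 1"
      using q2 by (simp add: card_Diff_singleton card_UNIV of_nat_diff)
    finally show ?thesis using True by (simp add: mod_eq_0_iff_dvd)
  next
    case False
    have "x ^ m = x ^ (m mod ?N)" for x :: 'a
      using red[of x] assms False by (cases "x = 0") (auto simp: power_0_left)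
    then have "(\<Sum>x\<in>(UNIV::'a set). x ^ m) = (\<Sum>x\<in>UNIV. x ^ (m mod ?N))"
      by (intro sum.cong) auto
    also have "\<dots> = 0"
      using sum_power_subfield_eq_0[of "UNIV :: 'a set" "m mod ?N"] False q2
      by (simp add: card_UNIV)
    finally show ?thesis using False by (simp add: mod_eq_0_iff_dvd)
  qed
qed

section \<open>Linear equivalence, cubing and quadratic equations\<close>

text \<open>This is the general shape of a \<open>K\<close>-linear endomorphism; by finiteness a
  trivial kernel suffices.\<close>

lemma Fq_lin_isoI:
  assumes "\<And>x. \<alpha> * x + \<beta> * cnj x = 0 \<Longrightarrow> x = 0"
  shows "Fq_lin_iso q (\<lambda>x. \<alpha> * x + \<beta> * cnj x)"
proof -
  have "inj (\<lambda>x. \<alpha> * x + \<beta> * cnj x)"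
  proof (rule injI)
    fix x y assume "\<alpha> * x + \<beta> * cnj x = \<alpha> * y + \<beta> * cnj y"
    then show "x = y" using assms[of "x - y"] by (simp add: algebra_simps)
  qed
  then have "bij (\<lambda>x. \<alpha> * x + \<beta> * cnj x)"
    by (simp add: bij_def finite_UNIV_inj_surj)
  then show ?thesis
    unfolding Fq_lin_iso_def by (auto simp: algebra_simps K_D)
qed

text \<open>Linear independence over \<open>K\<close>, as nonvanishing of the determinant with rows
  \<open>(x, cnj x)\<close> and \<open>(y, cnj y)\<close>.\<close>

definition indep :: "'a \<Rightarrow> 'a \<Rightarrow> bool" where
  "indep x y \<longleftrightarrow> x * cnj y \<noteq> cnj x * y"

lemma indepD:
  assumes "indep x y" "u \<in> K" "v \<in> K" "u * x + v * y = 0"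
  shows "u = 0 \<and> v = 0"
proof -
  have conj: "u * cnj x + v * cnj y = 0"
    using arg_cong[OF assms(4), of cnj] assms(2,3) by (simp add: K_D)
  \<comment> \<open>Cramer's rule for the relation together with its conjugate.\<close>
  have "u * (x * cnj y - cnj x * y) = (u * x + v * y) * cnj y - (u * cnj x + v * cnj y) * y"
    and "v * (x * cnj y - cnj x * y) = (u * cnj x + v * cnj y) * x - (u * x + v * y) * cnj x"
    by (simp_all add: algebra_simps)
  then show ?thesis
    using assms(1,4) conj by (simp add: indep_def)
qed

lemma indepI:
  assumes "x \<noteq> 0" "\<And>k. k \<in> K \<Longrightarrow> y \<noteq> k * x"
  shows "indep x y"
proof (rule ccontr)
  assume "\<not> indep x y"
  then have "y / x \<in> K"
    using assms(1) by (simp add: indep_def K_iff field_simps)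
  then show False using assms(2)[of "y / x"] assms(1) by simp
qed

lemma bij_betw_indep:
  assumes "indep x y"
  shows "bij_betw (\<lambda>(u, v). u * x + v * y) (K \<times> K) UNIV"
proof -
  have "inj_on (\<lambda>(u, v). u * x + v * y) (K \<times> K)"
  proof (rule inj_onI; safe)
    fix u v u' v' assume *: "u \<in> K" "v \<in> K" "u' \<in> K" "v' \<in> K" "u * x + v * y = u' * x + v' * y"
    then have "u - u' = 0 \<and> v - v' = 0"
      by (intro indepD[OF assms]) (auto simp: algebra_simps)
    then show "u = u'" "v = v'" by auto
  qed
  moreover from this have "(\<lambda>(u, v). u * x + v * y) ` (K \<times> K) = UNIV"
    by (intro card_subset_eq)
       (simp_all add: card_image card_cartesian_product card_K card_UNIV power2_eq_square)
  ultimately show ?thesis by (simp add: bij_betw_def)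
qed

lemma Fq_lin_iso_pairI:
  "indep x y \<Longrightarrow> Fq_lin_iso_pair q (\<lambda>(u, v). u * x + v * y)"
  using bij_betw_indep[of x y] unfolding Fq_lin_iso_pair_def by (auto simp: distrib_right distrib_left mult.assoc)

text \<open>Substituting \<open>\<eta> w\<close> for the argument removes the inverse, so that
  equivalences can be checked in coordinates.\<close>

lemma lin_equiv_pair_iff:
  "lin_equiv_pair q f g \<longleftrightarrow> (\<exists>\<rho> \<eta>. Fq_lin_iso_pair q \<rho> \<and> Fq_lin_iso_pair q \<eta> \<and>
     (\<forall>w \<in> K \<times> K. f (\<eta> w) = \<rho> (g w)))"
proof -
  have "(\<forall>u. f u = \<rho> (g (inv_into (K \<times> K) \<eta> u))) \<longleftrightarrow> (\<forall>w \<in> K \<times> K. f (\<eta> w) = \<rho> (g w))"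
    if "Fq_lin_iso_pair q \<eta>" for \<rho> \<eta>
  proof -
    have \<eta>: "bij_betw \<eta> (K \<times> K) UNIV" using that by (simp add: Fq_lin_iso_pair_def)
    show ?thesis
      using bij_betw_inv_into_left[OF \<eta>] bij_betw_inv_into_right[OF \<eta>]
        bij_betw_imp_surj_on[OF bij_betw_inv_into[OF \<eta>]]
      by (metis UNIV_I rangeI)
  qed
  then show ?thesis unfolding lin_equiv_pair_def by blast
qed

lemma lin_equiv_self_iff:
  "lin_equiv_self q f g \<longleftrightarrow> (\<exists>\<rho> \<eta>. Fq_lin_iso q \<rho> \<and> Fq_lin_iso q \<eta> \<and> (\<forall>x::'a. f (\<eta> x) = \<rho> (g x)))"
proof -
  have "(\<forall>u. f u = \<rho> (g (inv \<eta> u))) \<longleftrightarrow> (\<forall>x. f (\<eta> x) = \<rho> (g x))"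
    if "Fq_lin_iso q \<eta>" for \<rho> \<eta> :: "'a \<Rightarrow> 'a"
    using that unfolding Fq_lin_iso_def by (metis bij_inv_eq_iff)
  then show ?thesis unfolding lin_equiv_self_def by blast
qed

text \<open>A linear change of the source variable is absorbed into \<open>\<eta>\<close>. This and
  its analogue for pairs undo the passage to the coordinate of norm type.\<close>

lemma lin_equiv_self_comp:
  fixes \<eta> :: "'a \<Rightarrow> 'a"
  assumes "Fq_lin_iso q \<eta>" "lin_equiv_self q (\<lambda>x. f (\<eta> x)) g"
  shows "lin_equiv_self q f g"
proof -
  from assms(2) obtain \<rho> \<theta> where "Fq_lin_iso q \<rho>" "Fq_lin_iso q \<theta>" "\<forall>x. f (\<eta> (\<theta> x)) = \<rho> (g x)"
    by (auto simp: lin_equiv_self_iff)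
  moreover from this assms(1) have "Fq_lin_iso q (\<lambda>x. \<eta> (\<theta> x))"
    by (auto simp: Fq_lin_iso_def intro: bij_comp[unfolded comp_def])
  ultimately show ?thesis unfolding lin_equiv_self_iff by blast
qed

lemma lin_equiv_pair_comp:
  fixes \<eta> :: "'a \<Rightarrow> 'a"
  assumes "Fq_lin_iso q \<eta>" "lin_equiv_pair q (\<lambda>x. f (\<eta> x)) g"
  shows "lin_equiv_pair q f g"
proof -
  from assms(2) obtain \<rho> \<theta> where *: "Fq_lin_iso_pair q \<rho>" "Fq_lin_iso_pair q \<theta>"
      "\<forall>x\<in>K\<times>K. f (\<eta> (\<theta> x)) = \<rho> (g x)"
    by (auto simp: lin_equiv_pair_iff)
  have "bij_betw (\<lambda>x. \<eta> (\<theta> x)) (K \<times> K) UNIV"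
    using assms(1) * bij_betw_trans[of \<theta> "K \<times> K" UNIV \<eta> UNIV]
    by (auto simp: Fq_lin_iso_def Fq_lin_iso_pair_def comp_def)
  then have "Fq_lin_iso_pair q (\<lambda>x. \<eta> (\<theta> x))"
    using assms(1) * by (auto simp: Fq_lin_iso_def Fq_lin_iso_pair_def)
  with * show ?thesis unfolding lin_equiv_pair_iff by blast
qed

lemma lin_equiv_pairI:
  assumes "indep x y" "indep x' y'"
    and "\<And>u v. u \<in> K \<Longrightarrow> v \<in> K \<Longrightarrow> f (u * x + v * y) = fst (g (u, v)) * x' + snd (g (u, v)) * y'"
  shows "lin_equiv_pair q f g"
  unfolding lin_equiv_pair_iff
  using assms
  by (intro exI[of _ "\<lambda>(u, v). u * x' + v * y'"] exI[of _ "\<lambda>(u, v). u * x + v * y"] conjI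
      Fq_lin_iso_pairI) (auto simp: case_prod_beta)

lemma lin_equiv_pair_imp_bij:
  assumes "lin_equiv_pair q f g" "g ` (K \<times> K) \<subseteq> K \<times> K" "inj_on g (K \<times> K)"
  shows "bij f"
proof -
  from assms(1) obtain \<rho> \<eta> where \<rho>: "bij_betw \<rho> (K \<times> K) UNIV" and \<eta>: "bij_betw \<eta> (K \<times> K) UNIV"
      and f: "\<And>w. w \<in> K \<times> K \<Longrightarrow> f (\<eta> w) = \<rho> (g w)"
    by (auto simp: lin_equiv_pair_iff Fq_lin_iso_pair_def)
  have "inj f"
  proof (rule injI)
    fix x y assume "f x = f y"
    have "x \<in> \<eta> ` (K \<times> K)" "y \<in> \<eta> ` (K \<times> K)"
      using bij_betw_imp_surj_on[OF \<eta>] by simp_all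
    then obtain v w where vw: "v \<in> K \<times> K" "w \<in> K \<times> K" "x = \<eta> v" "y = \<eta> w"
      by (elim imageE)
    then have "\<rho> (g v) = \<rho> (g w)" using f \<open>f x = f y\<close> by simp
    then have "g v = g w"
      by (rule inj_onD[OF bij_betw_imp_inj_on[OF \<rho>]]) (use vw assms(2) in blast)+
    then have "v = w"
      by (rule inj_onD[OF assms(3)]) (use vw in blast)+
    then show "x = y" using vw by simp
  qed
  then show ?thesis by (simp add: bij_def finite_UNIV_inj_surj)
qed

section \<open>Cubing on \<open>K\<close> and cube roots of unity\<close>

lemma char_3: "q mod 3 = 0 \<Longrightarrow> (3::'a) = 0"
  using of_nat_eq_0_iff_prime[of 3] by (simp add: mod_eq_0_iff_dvd)

lemma not_char_3: "q mod 3 \<noteq> 0 \<Longrightarrow> (3::'a) \<noteq> 0"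
  using of_nat_eq_0_iff_prime[of 3] by (simp add: mod_eq_0_iff_dvd)

lemma char_3_cube_diff:
  assumes "(3::'a) = 0" shows "(x - y) ^ 3 = x ^ 3 - (y::'a) ^ 3"
proof -
  have "(x - y) ^ 3 = x ^ 3 - y ^ 3 - 3 * (x * y * (x - y))"
    by (simp add: algebra_simps power3_eq_cube)
  then show ?thesis using assms by simp
qed

text \<open>The exponent \<open>q\<close> of \<open>w\<close> may be reduced modulo 3.\<close>

lemma cube_eq_1_imp_cnj:
  assumes "q mod 3 = 2" "(w::'a) ^ 3 = 1"
  shows "cnj w = w ^ 2"
proof -
  have "cnj w = w ^ (3 * (q div 3) + q mod 3)" by (simp only: cnj_def mult_div_mod_eq)
  then show ?thesis using assms by (simp add: power_add power_mult power2_eq_square)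
qed

text \<open>In characteristic 3 cubing is additive. If \<open>q mod 3 = 2\<close>, a cube root of
  unity \<open>w\<close> in \<open>K\<close> satisfies \<open>w = cnj w = w ^ 2\<close>, hence is
  1.\<close>

lemma inj_on_cube_K:
  assumes "q mod 3 \<noteq> 1"
  shows "inj_on (\<lambda>x. x ^ 3) K"
proof (rule inj_onI)
  fix x y assume xy: "x \<in> K" "y \<in> K" "x ^ 3 = y ^ 3"
  consider "q mod 3 = 0" | "q mod 3 = 2" using assms by linarith
  then show "x = y"
  proof cases
    case 1
    then show ?thesis using char_3_cube_diff[of x y] xy char_3 by simp
  next
    case 2
    show ?thesis
    proof (cases "y = 0")
      case False
      then have "(x / y) ^ 3 = 1" using xy by (simp add: power_divide)
      then have "(x / y) ^ 2 = x / y"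
        using cube_eq_1_imp_cnj[OF 2, of "x / y"] xy by (simp add: K_D)
      then have "(x / y) * (x / y - 1) = 0" by (simp only: right_diff_distrib power2_eq_square) simp
      then have "x / y = 0 \<or> x / y = 1" by (metis mult_eq_0_iff eq_iff_diff_eq_0)
      then show ?thesis using \<open>(x / y) ^ 3 = 1\<close> by (auto simp: power_0_left)
    qed (use xy in auto)
  qed
qed

lemma surj_on_cube_K:
  assumes "q mod 3 \<noteq> 1" "x \<in> K"
  obtains y where "y \<in> K" "y ^ 3 = x"
proof -
  have "(\<lambda>x. x ^ 3) ` K = K"
    using inj_on_cube_K[OF assms(1)] by (intro endo_inj_surj) auto
  then show ?thesis using assms(2) that by (metis (no_types, lifting) imageE)
qed

text \<open>With \<open>m = (q - 1) div 3\<close>, every nonzero \<open>x\<close> in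
  \<open>K\<close> has \<open>(x ^ m) ^ 3 = 1\<close>, while at most \<open>m\<close> of them have
  \<open>x ^ m = 1\<close>.\<close>

lemma ex_cube_root_of_unity:
  assumes "q mod 3 = 1"
  obtains w where "w \<in> K" "w \<noteq> 1" "w ^ 3 = 1"
proof -
  have q: "q > 3" "(q - 1) mod 3 = 0"
    using assms q_ge_2 by presburger+
  define m where "m = (q - 1) div 3"
  have m: "3 * m = q - 1" "0 < m" "m < q - 1" using q unfolding m_def by auto
  obtain x where x: "x \<in> K" "x \<noteq> 0" "x ^ m \<noteq> 1"
  proof (rule ccontr)
    assume "\<not> thesis"
    then have "K - {0} \<subseteq> {x. x ^ m = 1}" using that by auto
    then have "card (K - {0}) \<le> m"
      by (intro order_trans[OF card_mono card_nth_root_le[OF m(2)]]) auto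
    then show False
      using m card_K by (simp add: card_Diff_singleton K_closed(1))
  qed
  have "x * x ^ (q - 1) = x"
    using x(1) q(1) by (simp add: Fq_def flip: power_Suc)
  then have "x ^ (q - 1) = 1" using x(2) by simp
  then show ?thesis
    using x m by (intro that[of "x ^ m"]) (auto simp: mult.commute simp flip: power_mult)
qed

text \<open>The value is the norm of \<open>x\<close> times \<open>x\<close>. Its own norm is the
  cube of the norm of \<open>x\<close>, so the value determines the norm of \<open>x\<close>, and
  then \<open>x\<close>.\<close>

lemma bij_power_q_plus_2:
  assumes "q mod 3 \<noteq> 1"
  shows "bij (\<lambda>x::'a. x ^ (q + 2))"
proof -
  have "inj (\<lambda>x::'a. x ^ (q + 2))"
  proof (rule injI)
    fix x y :: 'a assume "x ^ (q + 2) = y ^ (q + 2)"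
    then have eq: "(x * cnj x) * x = (y * cnj y) * y"
      by (simp add: cnj_def power_add power2_eq_square ac_simps)
    then have "((x * cnj x) * x) * cnj ((x * cnj x) * x) = ((y * cnj y) * y) * cnj ((y * cnj y) * y)"
      by simp
    then have "(x * cnj x) ^ 3 = (y * cnj y) ^ 3"
      by (simp add: power3_eq_cube ac_simps)
    then have "x * cnj x = y * cnj y"
      using inj_on_cube_K[OF assms] by (metis inj_onD norm_in_K)
    then show "x = y" using eq by (cases "x = 0") auto
  qed
  then show ?thesis by (simp add: bij_def finite_UNIV_inj_surj)
qed

section \<open>Quadratic equations over \<open>K\<close>\<close>

lemma monic_quadratic_roots:
  fixes z :: "'b::idom"
  assumes "x + y = s" "x * y = t" "z + w = s" "z * w = t"
  shows "(z = x \<and> w = y) \<or> (z = y \<and> w = x)"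
proof -
  have "(z - x) * (z - y) = z * z - (x + y) * z + x * y" by (simp add: algebra_simps)
  also have "\<dots> = z * z - (z + w) * z + z * w" using assms by simp
  also have "\<dots> = 0" by (simp add: algebra_simps)
  finally have "z = x \<or> z = y" by simp
  moreover have "w = x + y - z" using assms by (simp add: algebra_simps)
  ultimately show ?thesis by auto
qed

text \<open>The maps \<open>{x, y} \<mapsto> (x + y, x y)\<close> on pairs from \<open>K\<close> and \<open>z \<mapsto> (Tr z, N z)\<close> on
  non-elements of \<open>K\<close> have fibres of size at most two, so their images already exhaust the
  \<open>q\<^sup>2\<close> pairs of coefficients.\<close>
lemma quadratic_root_exists:
  assumes "b \<in> K" "c \<in> K"
  obtains z where "z ^ 2 + b * z + c = 0"
proof -
  define h :: "'a \<times> 'a \<Rightarrow> 'a \<times> 'a" where "h = (\<lambda>(x, y). (x + y, x * y))"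
  \<comment> \<open>Equal pairs from \<open>K\<close>, unequal pairs from \<open>K\<close>, and
    conjugate pairs: \<open>h\<close> is injective on the first set and at most two-to-one on the
    other two.\<close>
  define D where "D = (\<lambda>x. (x, x)) ` K"
  define O' where "O' = K \<times> K - D"
  define C where "C = (\<lambda>x. (x, cnj x)) ` (- K)"
  have h_eq: "w = (x, y) \<or> w = (y, x)" if "h w = h (x, y)" for w x y
    using monic_quadratic_roots[of x y _ _ "fst w" "snd w"] that
    by (auto simp: h_def case_prod_beta prod_eq_iff)
  have two: "card A \<le> 2 * card (h ` A)" for A
  proof (rule card_le_mult_card_image)
    fix y assume "y \<in> h ` A"
    then obtain s t where "y = h (s, t)" by auto
    then have "{x\<in>A. h x = y} \<subseteq> {(s, t), (t, s)}" using h_eq by auto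
    then have "card {x\<in>A. h x = y} \<le> card {(s, t), (t, s)}" by (intro card_mono) auto
    also have "\<dots> \<le> 2" by (cases "s = t") auto
    finally show "card {x\<in>A. h x = y} \<le> 2" .
  qed simp
  have "inj_on h D" using h_eq by (intro inj_onI) (auto simp: D_def)
  then have cD: "card (h ` D) = q"
    by (simp add: card_image D_def inj_on_def card_K)
  have "card D = q" "D \<subseteq> K \<times> K" by (auto simp: D_def card_image inj_on_def card_K)
  then have cO: "card O' = q * q - q"
    by (simp add: O'_def card_Diff_subset card_cartesian_product card_K)
  have cC: "card C = q * q - q"
    by (simp add: C_def card_image inj_on_def card_K card_UNIV Compl_eq_Diff_UNIV card_Diff_subset power2_eq_square)
  have KC: "w \<notin> C" if "w \<in> K \<times> K" for w using that by (auto simp: C_def)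
  have CC: "(y, x) \<in> C" if "(x, y) \<in> C" for x y using that by (auto simp: C_def K_iff image_iff)
  have disj1: "h ` D \<inter> h ` O' = {}"
    by (auto simp: D_def O'_def dest!: h_eq)
  have disj2: "(h ` D \<union> h ` O') \<inter> h ` C = {}"
  proof -
    have ne: "h w \<noteq> h w'" if "w \<in> K \<times> K" "w' \<in> C" for w w'
      using h_eq[of w "fst w'" "snd w'"] KC[OF that(1)] that(2) CC[of "fst w'" "snd w'"] by auto
    moreover have "h ` D \<union> h ` O' \<subseteq> h ` (K \<times> K)" using \<open>D \<subseteq> K \<times> K\<close> by (auto simp: O'_def)
    moreover have "h ` (K \<times> K) \<inter> h ` C = {}"
    proof (rule equals0I, elim IntE imageE)
      fix y w w' assume "y = h w" "w \<in> K \<times> K" "y = h w'" "w' \<in> C"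
      then show False using ne[of w w'] by simp
    qed
    ultimately show ?thesis by (simp add: disjoint_iff subset_iff)
  qed
  have "h ` D \<union> h ` O' \<union> h ` C \<subseteq> K \<times> K"
    using \<open>D \<subseteq> K \<times> K\<close> by (auto simp: h_def O'_def C_def)
  \<comment> \<open>The three disjoint images have at least \<open>q\<close>,
    \<open>(q * q - q) / 2\<close> and \<open>(q * q - q) / 2\<close> elements.\<close>
  moreover have "card (K \<times> K) \<le> card (h ` D \<union> h ` O' \<union> h ` C)"
  proof -
    have "q \<le> q * q" by simp
    moreover have "card (h ` D \<union> h ` O' \<union> h ` C) = q + card (h ` O') + card (h ` C)"
      using disj1 disj2 cD by (simp add: card_Un_disjoint)
    moreover have "q * q - q \<le> 2 * card (h ` O')" "q * q - q \<le> 2 * card (h ` C)"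
      using two[of O'] two[of C] cO cC by simp_all
    ultimately show ?thesis by (simp add: card_cartesian_product card_K)
  qed
  ultimately have "h ` D \<union> h ` O' \<union> h ` C = K \<times> K"
    by (intro card_seteq) auto
  moreover have "(- b, c) \<in> K \<times> K" using assms by auto
  ultimately have "(- b, c) \<in> range h" by auto
  then obtain x y where "x + y = - b" "x * y = c" by (auto simp: h_def)
  then have "x ^ 2 + b * x + c = x ^ 2 - (x + y) * x + x * y" by simp
  also have "\<dots> = 0" by (simp add: algebra_simps power2_eq_square)
  finally show ?thesis by (rule that)
qed

section \<open>Power sums of pairs of binary cubic forms\<close>

text \<open>Hermite's criterion in two variables: the sum over the field becomes one over
  \<open>K \<times> K\<close>, which factors, and \<open>i\<close> and \<open>j\<close> cannot both
  reach \<open>q - 1\<close>.\<close>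

lemma power_sum_eq_0_of_bij:
  assumes "bij_betw (\<lambda>x::'a. (g x, h x)) UNIV (K \<times> K)" "i + j = q - 1"
  shows "(\<Sum>x\<in>UNIV. g x ^ i * h x ^ j) = 0"
proof -
  have "(\<Sum>x\<in>UNIV. g x ^ i * h x ^ j) = (\<Sum>x\<in>UNIV. (\<lambda>(u, v). u ^ i * v ^ j) (g x, h x))"
    by simp
  also have "\<dots> = (\<Sum>(u, v)\<in>K \<times> K. u ^ i * v ^ j)"
    by (rule sum.reindex_bij_betw[OF assms(1)])
  also have "\<dots> = (\<Sum>u\<in>K. u ^ i) * (\<Sum>v\<in>K. v ^ j)"
    by (simp add: sum_product sum.cartesian_product)
  also have "\<dots> = 0"
  proof (cases "i = 0")
    case True
    then show ?thesis using sum_power_K_eq_0[of i] q_ge_2 by simp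
  next
    case False
    then show ?thesis using sum_power_K_eq_0[of j] assms(2) by simp
  qed
  finally show ?thesis .
qed

lemma sum_shifted_binomial:
  "(\<Sum>k\<le>i. if k + n + 1 = j then of_nat (i choose k) else 0) =
    (if n < j then of_nat (i choose (j - 1 - n)) else (0::'a))"
proof (cases "n < j")
  case True
  then have "k + n + 1 = j \<longleftrightarrow> k = j - 1 - n" for k by auto
  then show ?thesis using True by (simp add: sum.delta not_le binomial_eq_0)
qed auto

text \<open>Only two exponents in the binomial expansion are multiples of \<open>q\<^sup>2 - 1\<close>.\<close>
lemma sum_norm_form_monomial:
  assumes ij: "i + j = q - 1" and mn: "m + n = 3 * j"
  shows "(\<Sum>x\<in>(UNIV::'a set). (x * cnj x * (x + cnj x)) ^ i * (x ^ m * cnj x ^ n)) =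
     - ((if n < j then of_nat (i choose (j - 1 - n)) else 0) +
        (if m < j then of_nat (i choose (j - 1 - m)) else 0))"
proof -
  \<comment> \<open>The exponent of \<open>x\<close> in the term of the expanded
    \<open>(cnj x + x) ^ i\<close> that has \<open>cnj x ^ k\<close>, once \<open>cnj x\<close> is
    written as \<open>x ^ q\<close>.\<close>
  define e where "e k = (i + m) + (i - k) + q * (i + n + k)" for k
  have q: "q = Suc (i + j)" using ij q_ge_2 by simp
  have e: "e k = (q - 1) * (3 + i + n + k)" if "k \<le> i" for k
  proof -
    have "e k = ((i + m) + (i - k) + (i + n + k)) + (q - 1) * (i + n + k)"
      by (simp add: e_def q)
    also have "(i + m) + (i - k) + (i + n + k) = (q - 1) * 3"
      using that mn q by simp
    finally show ?thesis by (simp only: distrib_left[symmetric] add.assoc)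
  qed
  \<comment> \<open>Cancelling \<open>q - 1\<close> leaves divisibility of
    \<open>3 + i + n + k\<close> by \<open>q + 1\<close>. That number lies strictly between 0 and
    \<open>3 * (q + 1)\<close>, so it is \<open>q + 1\<close> or \<open>2 * (q + 1)\<close>; these
    are the two alternatives.\<close>
  have dvd: "q ^ 2 - 1 dvd e k \<longleftrightarrow> k + n + 1 = j \<or> (i - k) + m + 1 = j" if "k \<le> i" for k
  proof -
    have "q ^ 2 - 1 = (q - 1) * (q + 1)"
      by (simp add: algebra_simps power2_eq_square)
    then have "q ^ 2 - 1 dvd e k \<longleftrightarrow> q + 1 dvd 3 + i + n + k"
      unfolding e[OF that] using q_ge_2 by (simp only: nat_mult_dvd_cancel_disj) simp
    also have "\<dots> \<longleftrightarrow> k + n + 1 = j \<or> (i - k) + m + 1 = j"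
    proof
      assume "q + 1 dvd 3 + i + n + k"
      then obtain t where t: "3 + i + n + k = (q + 1) * t" by (elim dvdE)
      have "t \<noteq> 0" using t by (cases "t = 0") auto
      moreover have "t < 3"
      proof (rule ccontr)
        assume "\<not> t < 3"
        then have "(q + 1) * 3 \<le> (q + 1) * t" by (intro mult_le_mono2) simp
        then show False using t that mn q by simp
      qed
      ultimately have "t = 1 \<or> t = 2" by auto
      then show "k + n + 1 = j \<or> (i - k) + m + 1 = j" using t that mn q by auto
    next
      assume "k + n + 1 = j \<or> (i - k) + m + 1 = j"
      then have "3 + i + n + k = (q + 1) * 1 \<or> 3 + i + n + k = (q + 1) * 2"
        using that mn q by auto
      then show "q + 1 dvd 3 + i + n + k" by (metis dvd_triv_left)
    qed
    finally show ?thesis .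
  qed
  have disj: "\<not> (k + n + 1 = j \<and> (i - k) + m + 1 = j)" if "k \<le> i" for k
    using that mn q by auto
  have e_pos: "e k > 0" if "k \<le> i" for k using e[OF that] q_ge_2 by simp
  have "(\<Sum>x\<in>(UNIV::'a set). (x * cnj x * (x + cnj x)) ^ i * (x ^ m * cnj x ^ n))
      = (\<Sum>x\<in>(UNIV::'a set). \<Sum>k\<le>i. of_nat (i choose k) * x ^ e k)"
  proof (rule sum.cong[OF refl])
    fix x :: 'a
    have "(x * cnj x * (x + cnj x)) ^ i * (x ^ m * cnj x ^ n)
        = x ^ (i + m) * cnj x ^ (i + n) * (cnj x + x) ^ i"
      by (simp add: power_mult_distrib power_add add.commute ac_simps)
    also have "\<dots> = (\<Sum>k\<le>i. of_nat (i choose k) * x ^ e k)"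
      unfolding binomial_ring sum_distrib_left
    proof (rule sum.cong[OF refl])
      fix k
      have "x ^ e k = x ^ (i + m) * x ^ (i - k) * (cnj x ^ (i + n) * cnj x ^ k)"
        unfolding e_def cnj_def by (simp only: power_add power_mult)
      then show "x ^ (i + m) * cnj x ^ (i + n) * (of_nat (i choose k) * cnj x ^ k * x ^ (i - k)) =
          of_nat (i choose k) * x ^ e k"
        by (simp only: ac_simps)
    qed
    finally show "(x * cnj x * (x + cnj x)) ^ i * (x ^ m * cnj x ^ n) = \<dots>" .
  qed
  also have "\<dots> = (\<Sum>k\<le>i. of_nat (i choose k) * (\<Sum>x\<in>(UNIV::'a set). x ^ e k))"
    by (subst sum.swap) (simp add: sum_distrib_left)
  also have "\<dots> = (\<Sum>k\<le>i. - ((if k + n + 1 = j then of_nat (i choose k) else 0) +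
      (if (i - k) + m + 1 = j then of_nat (i choose (i - k)) else 0)))"
  proof (rule sum.cong[OF refl])
    fix k assume "k \<in> {..i}"
    then have k: "k \<le> i" by simp
    show "of_nat (i choose k) * (\<Sum>x\<in>(UNIV::'a set). x ^ e k) =
      - ((if k + n + 1 = j then of_nat (i choose k) else 0) +
      (if (i - k) + m + 1 = j then of_nat (i choose (i - k)) else 0))"
      unfolding sum_power_UNIV[OF e_pos[OF k]] dvd[OF k] binomial_symmetric[OF k, symmetric]
      using disj[OF k] by auto
  qed
  also have "\<dots> = - ((\<Sum>k\<le>i. if k + n + 1 = j then of_nat (i choose k) else 0) +
      (\<Sum>k\<le>i. if (i - k) + m + 1 = j then of_nat (i choose (i - k)) else 0))"
    by (simp only: sum_negf sum.distrib)
  also have "(\<Sum>k\<le>i. if (i - k) + m + 1 = j then of_nat (i choose (i - k)) else (0::'a))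
      = (\<Sum>k\<le>i. if k + m + 1 = j then of_nat (i choose k) else 0)"
    by (rule sum.reindex_bij_witness[of _ "\<lambda>k. i - k" "\<lambda>k. i - k"]) auto
  finally show ?thesis by (simp only: sum_shifted_binomial)
qed

text \<open>The coefficients make \<open>h\<close> a general \<open>K\<close>-valued cubic form. The
  power sums with \<open>h\<close> to the first, second and, in characteristic 2, third power are
  expanded; few monomials survive. The last alternative is an extra factor of the cubic relation, to
  be excluded later.\<close>

lemma power_sums_of_norm_form_pair:
  fixes r s \<kappa> :: 'a
  defines "h \<equiv> \<lambda>x. r * x ^ 3 + s * (x ^ 2 * cnj x) + cnj s * (x * cnj x ^ 2) + cnj r * cnj x ^ 3"
  assumes q: "q \<ge> 3" and "\<kappa> \<noteq> 0"
    and bij: "bij_betw (\<lambda>x. (\<kappa> * (x * cnj x * (x + cnj x)), h x)) UNIV (K \<times> K)"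
  shows "cnj r = - r" "r = 0 \<or> s - cnj s = 3 * r \<or> ((2::'a) = 0 \<and> s + cnj s = 0)"
proof -
  define T where "T i m n = (\<Sum>x\<in>(UNIV::'a set). (x * cnj x * (x + cnj x)) ^ i * (x ^ m * cnj x ^ n))"
    for i m n
  have T: "T i m n = - ((if n < j then of_nat (i choose (j - 1 - n)) else 0) +
        (if m < j then of_nat (i choose (j - 1 - m)) else 0))"
    if "i + j = q - 1" "m + n = 3 * j" for i j m n
    unfolding T_def using that by (rule sum_norm_form_monomial)
  have sum0: "(\<Sum>x\<in>UNIV. (x * cnj x * (x + cnj x)) ^ i * h x ^ j) = 0" if "i + j = q - 1" for i j
  proof -
    have "\<kappa> ^ i * (\<Sum>x\<in>UNIV. (x * cnj x * (x + cnj x)) ^ i * h x ^ j)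
        = (\<Sum>x\<in>UNIV. (\<kappa> * (x * cnj x * (x + cnj x))) ^ i * h x ^ j)"
      by (simp add: sum_distrib_left power_mult_distrib mult.assoc)
    also have "\<dots> = 0" using power_sum_eq_0_of_bij[OF bij that] .
    finally show ?thesis using \<open>\<kappa> \<noteq> 0\<close> by simp
  qed
  \<comment> \<open>First power of \<open>h\<close>: only the pure cubes of \<open>x\<close> and
    \<open>cnj x\<close> contribute, each with sum -1.\<close>
  show r: "cnj r = - r"
  proof -
    obtain i where i: "i + 1 = q - 1" using q that[of "q - 2"] by simp
    have "0 = (\<Sum>x\<in>UNIV. (x * cnj x * (x + cnj x)) ^ i * h x ^ 1)"
      using sum0[OF i] by simp
    also have "\<dots> = (\<Sum>x\<in>UNIV. r * ((x * cnj x * (x + cnj x)) ^ i * (x ^ 3 * cnj x ^ 0))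
        + s * ((x * cnj x * (x + cnj x)) ^ i * (x ^ 2 * cnj x ^ 1))
        + cnj s * ((x * cnj x * (x + cnj x)) ^ i * (x ^ 1 * cnj x ^ 2))
        + cnj r * ((x * cnj x * (x + cnj x)) ^ i * (x ^ 0 * cnj x ^ 3)))"
      by (rule sum.cong[OF refl]) (simp add: h_def algebra_simps)
    also have "\<dots> = r * T i 3 0 + s * T i 2 1 + cnj s * T i 1 2 + cnj r * T i 0 3"
      by (simp only: sum.distrib T_def sum_distrib_left)
    also have "\<dots> = - (r + cnj r)"
      by (simp add: T[OF i])
    finally show ?thesis by (simp add: eq_neg_iff_add_eq_0 add.commute)
  qed
  show "r = 0 \<or> s - cnj s = 3 * r \<or> ((2::'a) = 0 \<and> s + cnj s = 0)"
  proof (cases "(2::'a) = 0")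
    case False
    \<comment> \<open>Second power of \<open>h\<close>. The binomial coefficient
      \<open>i choose 1\<close> enters as -3, because \<open>q\<close> is zero in the field.\<close>
    define i where "i = q - 3"
    have i: "i + 2 = q - 1" using q by (simp add: i_def)
    have "of_nat i + 3 = (of_nat q :: 'a)" using q unfolding i_def by (simp add: of_nat_diff)
    then have "of_nat i = - (3::'a)" by (simp add: eq_neg_iff_add_eq_0)
    define P where "P x = (x * cnj x * (x + cnj x)) ^ i" for x
    have "0 = (\<Sum>x\<in>UNIV. P x * h x ^ 2)"
      using sum0[OF i] by (simp add: P_def)
    also have "\<dots> = (\<Sum>x\<in>UNIV. r ^ 2 * (P x * (x ^ 6 * cnj x ^ 0))
        + (2 * r * s) * (P x * (x ^ 5 * cnj x ^ 1))
        + (s ^ 2 + 2 * r * cnj s) * (P x * (x ^ 4 * cnj x ^ 2))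
        + (2 * r * cnj r + 2 * s * cnj s) * (P x * (x ^ 3 * cnj x ^ 3))
        + (cnj s ^ 2 + 2 * cnj r * s) * (P x * (x ^ 2 * cnj x ^ 4))
        + (2 * cnj r * cnj s) * (P x * (x ^ 1 * cnj x ^ 5))
        + cnj r ^ 2 * (P x * (x ^ 0 * cnj x ^ 6)))"
      by (rule sum.cong[OF refl])
         (simp add: h_def power2_eq_square power3_eq_cube eval_nat_numeral algebra_simps)
    also have "\<dots> = r ^ 2 * T i 6 0 + (2 * r * s) * T i 5 1 + (s ^ 2 + 2 * r * cnj s) * T i 4 2
        + (2 * r * cnj r + 2 * s * cnj s) * T i 3 3 + (cnj s ^ 2 + 2 * cnj r * s) * T i 2 4
        + (2 * cnj r * cnj s) * T i 1 5 + cnj r ^ 2 * T i 0 6"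
      by (simp only: sum.distrib T_def P_def sum_distrib_left)
    also have "\<dots> = 3 * r ^ 2 - 2 * r * s - 2 * cnj r * cnj s + 3 * cnj r ^ 2"
      by (simp add: T[OF i] \<open>of_nat i = - 3\<close>)
    also have "\<dots> = 2 * (- r * (s - cnj s - 3 * r))"
      unfolding r by (simp add: power2_eq_square algebra_simps)
    finally show ?thesis using False by simp
  next
    case True
    then have "2 dvd q" using of_nat_eq_0_iff_prime[of 2] by simp
    \<comment> \<open>In characteristic 2 the relation from the second power vanishes identically,
      so the third power is used with \<open>i = q - 4\<close>. Divisibility by 4 makes
      \<open>i\<close> and \<open>i choose 2\<close> even, which leaves only the monomials with
      exponents 7 and 2.\<close>
    have "4 dvd q"
    proof -
      obtain k where k: "k > 0" "prime CHAR('a)" "q = CHAR('a) ^ k" using q_eq_CHAR_power by blast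
      have "CHAR('a) = 2"
        using k \<open>2 dvd q\<close> by (metis prime_dvd_power primes_dvd_imp_eq two_is_prime_nat)
      then have "k \<noteq> 1" using k q by auto
      then have "k = 2 + (k - 2)" using k by simp
      then have "q = 2 ^ (2 + (k - 2))" using k \<open>CHAR('a) = 2\<close> by metis
      then show ?thesis by (simp add: power_add)
    qed
    define i where "i = q - 4"
    have "q \<ge> 4" using \<open>4 dvd q\<close> q by (auto intro: dvd_imp_le)
    then have i: "i + 3 = q - 1" by (simp add: i_def)
    have "4 dvd i" using \<open>4 dvd q\<close> \<open>q \<ge> 4\<close> by (simp add: i_def)
    then obtain t where t: "i = 4 * t" by (elim dvdE)
    have even0: "of_nat (2 * n) = (0::'a)" for n using True by simp
    have "of_nat i = (0::'a)" using even0[of "2 * t"] t by simp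
    moreover have "i choose 2 = 2 * (t * (i - 1))"
      using t by (simp add: choose_two)
    then have "of_nat (i choose 2) = (0::'a)" using even0 by metis
    ultimately have C: "of_nat i = (0::'a)" "of_nat (i choose 2) = (0::'a)" .
    define P where "P x = (x * cnj x * (x + cnj x)) ^ i" for x
    have "0 = (\<Sum>x\<in>UNIV. P x * h x ^ 3)"
      using sum0[OF i] by (simp add: P_def)
    also have "\<dots> = (\<Sum>x\<in>UNIV. r ^ 3 * (P x * (x ^ 9 * cnj x ^ 0))
        + (3 * r ^ 2 * s) * (P x * (x ^ 8 * cnj x ^ 1))
        + (3 * r ^ 2 * cnj s + 3 * r * s ^ 2) * (P x * (x ^ 7 * cnj x ^ 2))
        + (s ^ 3 + 6 * r * s * cnj s + 3 * r ^ 2 * cnj r) * (P x * (x ^ 6 * cnj x ^ 3))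
        + (3 * s ^ 2 * cnj s + 3 * r * cnj s ^ 2 + 6 * r * s * cnj r) * (P x * (x ^ 5 * cnj x ^ 4))
        + (3 * cnj s ^ 2 * s + 3 * cnj r * s ^ 2 + 6 * cnj r * cnj s * r) * (P x * (x ^ 4 * cnj x ^ 5))
        + (cnj s ^ 3 + 6 * cnj r * s * cnj s + 3 * cnj r ^ 2 * r) * (P x * (x ^ 3 * cnj x ^ 6))
        + (3 * cnj r ^ 2 * s + 3 * cnj r * cnj s ^ 2) * (P x * (x ^ 2 * cnj x ^ 7))
        + (3 * cnj r ^ 2 * cnj s) * (P x * (x ^ 1 * cnj x ^ 8))
        + cnj r ^ 3 * (P x * (x ^ 0 * cnj x ^ 9)))"
      by (rule sum.cong[OF refl])
         (simp add: h_def power2_eq_square power3_eq_cube eval_nat_numeral algebra_simps)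
    also have "\<dots> = r ^ 3 * T i 9 0 + (3 * r ^ 2 * s) * T i 8 1
        + (3 * r ^ 2 * cnj s + 3 * r * s ^ 2) * T i 7 2
        + (s ^ 3 + 6 * r * s * cnj s + 3 * r ^ 2 * cnj r) * T i 6 3
        + (3 * s ^ 2 * cnj s + 3 * r * cnj s ^ 2 + 6 * r * s * cnj r) * T i 5 4
        + (3 * cnj s ^ 2 * s + 3 * cnj r * s ^ 2 + 6 * cnj r * cnj s * r) * T i 4 5
        + (cnj s ^ 3 + 6 * cnj r * s * cnj s + 3 * cnj r ^ 2 * r) * T i 3 6
        + (3 * cnj r ^ 2 * s + 3 * cnj r * cnj s ^ 2) * T i 2 7
        + (3 * cnj r ^ 2 * cnj s) * T i 1 8 + cnj r ^ 3 * T i 0 9"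
      by (simp only: sum.distrib T_def P_def sum_distrib_left)
    also have "\<dots> = - (3 * r ^ 2 * cnj s + 3 * r * s ^ 2) - (3 * cnj r ^ 2 * s + 3 * cnj r * cnj s ^ 2)"
      by (simp add: T[OF i] C numeral_2_eq_2[symmetric])
    also have "\<dots> = (- (s + cnj s)) * (r * (s - cnj s - 3 * r)) + 2 * ((s + cnj s) * (- 3 * r ^ 2 - r * (s - cnj s)))"
      unfolding r by (simp add: power2_eq_square algebra_simps)
    finally have "0 = (s + cnj s) * (r * (s - cnj s - 3 * r))"
      unfolding True by (simp only: mult_zero_left add_0_right mult_minus_left neg_0_equal_iff_equal)
    then have "(s + cnj s) * (r * (s - cnj s - 3 * r)) = 0" by (rule sym)
    then have "s + cnj s = 0 \<or> r = 0 \<or> s - cnj s - 3 * r = 0" by (simp only: mult_eq_0_iff)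
    then show ?thesis using True by (simp only: right_minus_eq) blast
  qed
qed

section \<open>Cubic forms with a triple fibre\<close>

definition cubic_form :: "('a \<Rightarrow> 'a) \<Rightarrow> bool" where
  "cubic_form f \<longleftrightarrow> (\<exists>a b c d. \<forall>x. f x =
     a * cnj x ^ 3 + b * (cnj x ^ 2 * x) + c * (cnj x * x ^ 2) + d * x ^ 3)"

lemma cubic_form_add: "cubic_form f \<Longrightarrow> cubic_form g \<Longrightarrow> cubic_form (\<lambda>x. f x + g x)"
  unfolding cubic_form_def
proof (elim exE)
  fix a b c d a' b' c' d'
  assume "\<forall>x. f x = a * cnj x ^ 3 + b * (cnj x ^ 2 * x) + c * (cnj x * x ^ 2) + d * x ^ 3"
    "\<forall>x. g x = a' * cnj x ^ 3 + b' * (cnj x ^ 2 * x) + c' * (cnj x * x ^ 2) + d' * x ^ 3"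
  then show "\<exists>a b c d. \<forall>x. f x + g x =
      a * cnj x ^ 3 + b * (cnj x ^ 2 * x) + c * (cnj x * x ^ 2) + d * x ^ 3"
    by (intro exI[of _ "a + a'"] exI[of _ "b + b'"] exI[of _ "c + c'"] exI[of _ "d + d'"])
       (simp add: algebra_simps)
qed

text \<open>After a linear substitution each monomial is a product of three linear forms, so this
  and additivity give closure under substitution.\<close>

lemma cubic_form_mult_linear:
  "cubic_form (\<lambda>x. k * ((l1 * x + m1 * cnj x) * (l2 * x + m2 * cnj x) * (l3 * x + m3 * cnj x)))"
  unfolding cubic_form_def
  by (intro exI[of _ "k * (m1 * m2 * m3)"] exI[of _ "k * (m1 * m2 * l3 + m1 * l2 * m3 + l1 * m2 * m3)"]
      exI[of _ "k * (l1 * l2 * m3 + l1 * m2 * l3 + m1 * l2 * l3)"] exI[of _ "k * (l1 * l2 * l3)"])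
     (simp add: algebra_simps power2_eq_square power3_eq_cube)

lemma cubic_form_comp_linear:
  assumes "cubic_form f"
  shows "cubic_form (\<lambda>x. f (\<alpha> * x + \<beta> * cnj x))"
proof -
  obtain a b c d where
    f: "\<And>x. f x = a * cnj x ^ 3 + b * (cnj x ^ 2 * x) + c * (cnj x * x ^ 2) + d * x ^ 3"
    using assms unfolding cubic_form_def by blast
  define y where "y x = \<alpha> * x + \<beta> * cnj x" for x
  define y' where "y' x = cnj \<beta> * x + cnj \<alpha> * cnj x" for x
  have "f (\<alpha> * x + \<beta> * cnj x) = a * (y' x * y' x * y' x) + b * (y' x * y' x * y x)
      + c * (y' x * y x * y x) + d * (y x * y x * y x)" for x
    unfolding f y_def y'_def by (simp add: power2_eq_square power3_eq_cube add.commute mult.assoc)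
  then show ?thesis
    unfolding y_def y'_def by (simp only: cubic_form_add cubic_form_mult_linear)
qed

lemma cubic_form_basis:
  assumes "cubic_form f"
  obtains \<beta>\<^sub>0 \<beta>\<^sub>1 \<beta>\<^sub>2 \<beta>\<^sub>3 where
    "\<And>u v. u \<in> K \<Longrightarrow> v \<in> K \<Longrightarrow>
      f (u * x + v * y) = \<beta>\<^sub>0 * u ^ 3 + \<beta>\<^sub>1 * (u ^ 2 * v) + \<beta>\<^sub>2 * (u * v ^ 2) + \<beta>\<^sub>3 * v ^ 3"
proof -
  obtain a b c d where
    f: "\<And>x. f x = a * cnj x ^ 3 + b * (cnj x ^ 2 * x) + c * (cnj x * x ^ 2) + d * x ^ 3"
    using assms unfolding cubic_form_def by blast
  define x' y' where "x' = cnj x" and "y' = cnj y"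
  show ?thesis
  proof (rule that)
    fix u v assume uv: "u \<in> K" "v \<in> K"
    have c: "cnj (u * x + v * y) = u * x' + v * y'"
      using uv by (simp add: K_D x'_def y'_def)
    show "f (u * x + v * y) =
      (a * x' ^ 3 + b * (x' ^ 2 * x) + c * (x' * x ^ 2) + d * x ^ 3) * u ^ 3
      + (3 * a * x' ^ 2 * y' + b * (2 * x' * y' * x + x' ^ 2 * y) + c * (y' * x ^ 2 + 2 * x' * x * y)
          + 3 * d * x ^ 2 * y) * (u ^ 2 * v)
      + (3 * a * x' * y' ^ 2 + b * (2 * x' * y' * y + y' ^ 2 * x) + c * (x' * y ^ 2 + 2 * y' * x * y)
          + 3 * d * x * y ^ 2) * (u * v ^ 2)
      + (a * y' ^ 3 + b * (y' ^ 2 * y) + c * (y' * y ^ 2) + d * y ^ 3) * v ^ 3"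
      unfolding f c by (simp add: algebra_simps power2_eq_square power3_eq_cube)
  qed
qed

lemma cubic_form_scale: "cubic_form f \<Longrightarrow> k \<in> K \<Longrightarrow> f (k * x) = k ^ 3 * f x"
  unfolding cubic_form_def
  by (auto simp: K_D power_mult_distrib algebra_simps power2_eq_square power3_eq_cube)

lemma cubic_form_0 [simp]: "cubic_form f \<Longrightarrow> f 0 = 0"
  using cubic_form_scale[of f 0 0] K_closed(1) by simp

lemma indep_add_scaled:
  assumes "indep x y" "k \<in> K"
  shows "indep x (y + k * x)"
  using assms by (simp add: indep_def K_D algebra_simps)

section \<open>Cubic polynomials that permute \<open>K\<close>\<close>

text \<open>Hermite's criterion with exponent \<open>k = (q + 1) div 3\<close>: the power has degree
  \<open>q + 1\<close>, and only its term of degree \<open>q - 1\<close>, with coefficient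
  \<open>k * c\<close>, has a nonzero sum. As \<open>3 * k = 1\<close> in the field,
  \<open>k\<close> does not vanish there.\<close>

lemma cubic_perm_linear_coeff:
  assumes q: "q \<ge> 3" "q mod 3 = 2" and c: "c \<in> K" and inj: "inj_on (\<lambda>t. t ^ 3 + c * t) K"
  shows "c = 0"
proof -
  define k where "k = (q + 1) div 3"
  have k: "3 * k = q + 1" using q unfolding k_def by presburger
  have q5: "q \<ge> 5" using q by presburger
  have image: "(\<lambda>t. t ^ 3 + c * t) ` K = K"
    using inj c by (intro endo_inj_surj) auto
  \<comment> \<open>For \<open>l = 0\<close> the exponent \<open>q + 1\<close> reduces to 2 on
    \<open>K\<close>, which is below \<open>q - 1\<close> because \<open>q \<ge> 5\<close>; for
    \<open>l \<ge> 2\<close> it is itself below \<open>q - 1\<close>.\<close>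
  have sums: "(\<Sum>t\<in>K. t ^ (q + 1 - 2 * l)) = (if l = 1 then - 1 else 0)" if "l \<le> k" for l
  proof -
    consider "l = 0" | "l = 1" | "l \<ge> 2" by linarith
    then show ?thesis
    proof cases
      case 1
      have "t ^ (q + 1) = t ^ 2" if "t \<in> K" for t
        using that by (simp add: Fq_def power2_eq_square)
      then have "(\<Sum>t\<in>K. t ^ (q + 1)) = (\<Sum>t\<in>K. t ^ 2)" by (rule sum.cong[OF refl])
      then show ?thesis using 1 sum_power_K_eq_0[of 2] q5 by simp
    next
      case 2
      have "t ^ (q - 1) = 1" if "t \<in> K - {0}" for t
        using that power_minus_mult[of q t] q5 by (auto simp: Fq_def)
      then have "(\<Sum>t\<in>K - {0}. t ^ (q - 1)) = of_nat (card (K - {0}))" by simp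
      also have "\<dots> = - 1"
        using q5 by (simp add: card_Diff_singleton K_closed(1) card_K of_nat_diff)
      also have "(\<Sum>t\<in>K - {0}. t ^ (q - 1)) = (\<Sum>t\<in>K. t ^ (q - 1))"
        using q5 by (intro sum.mono_neutral_left) auto
      finally show ?thesis using 2 by simp
    next
      case 3
      then show ?thesis using sum_power_K_eq_0[of "q + 1 - 2 * l"] q5 by simp
    qed
  qed
  have "0 = (\<Sum>t\<in>K. t ^ k)" using sum_power_K_eq_0[of k] k q5 by simp
  also have "\<dots> = (\<Sum>t\<in>(\<lambda>t. t ^ 3 + c * t) ` K. t ^ k)" by (simp only: image)
  also have "\<dots> = (\<Sum>t\<in>K. (t ^ 3 + c * t) ^ k)"
    by (simp add: sum.reindex[OF inj])
  also have "\<dots> = (\<Sum>t\<in>K. \<Sum>l\<le>k. (of_nat (k choose l) * c ^ l) * t ^ (q + 1 - 2 * l))"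
  proof (rule sum.cong[OF refl])
    fix t
    have "(t ^ 3 + c * t) ^ k = (c * t + t ^ 3) ^ k" by (simp add: add.commute)
    also have "\<dots> = (\<Sum>l\<le>k. (of_nat (k choose l) * c ^ l) * t ^ (q + 1 - 2 * l))"
      unfolding binomial_ring
    proof (rule sum.cong[OF refl])
      fix l assume "l \<in> {..k}"
      then have "q + 1 - 2 * l = l + 3 * (k - l)" using k by simp
      then have "t ^ (q + 1 - 2 * l) = t ^ l * (t ^ 3) ^ (k - l)"
        by (simp only: power_add power_mult)
      then show "of_nat (k choose l) * (c * t) ^ l * (t ^ 3) ^ (k - l)
          = of_nat (k choose l) * c ^ l * t ^ (q + 1 - 2 * l)"
        by (simp only: power_mult_distrib ac_simps)
    qed
    finally show "(t ^ 3 + c * t) ^ k = \<dots>" .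
  qed
  also have "\<dots> = (\<Sum>l\<le>k. (of_nat (k choose l) * c ^ l) * (\<Sum>t\<in>K. t ^ (q + 1 - 2 * l)))"
    by (subst sum.swap) (simp only: sum_distrib_left)
  also have "\<dots> = (\<Sum>l\<le>k. if l = 1 then - (of_nat k * c) else 0)"
    by (rule sum.cong[OF refl]) (simp add: sums choose_one del: One_nat_def)
  also have "\<dots> = - (of_nat k * c)"
    using k by (simp add: sum.delta)
  finally have "of_nat k * c = 0" by simp
  moreover have "of_nat (3 * k) = (1::'a)" unfolding k by simp
  then have "of_nat k \<noteq> (0::'a)" by auto
  ultimately show ?thesis by simp
qed

text \<open>If \<open>b \<noteq> 0\<close>, the polynomial minus its value at a critical point
  \<open>t\<close> is \<open>(X - t) ^ 2 * (X - t + b)\<close>, so \<open>t\<close> and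
  \<open>t - b\<close> collide.\<close>

lemma cubic_perm_char_3_quadratic_coeff:
  assumes "(3::'a) = 0" "b \<in> K" "c \<in> K" and inj: "inj_on (\<lambda>t. t ^ 3 + b * t ^ 2 + c * t) K"
  shows "b = 0"
proof (rule ccontr)
  assume b: "b \<noteq> 0"
  define t where "t = c / b"
  have t: "t \<in> K" "c = b * t" using assms b by (auto simp: t_def)
  \<comment> \<open>The point \<open>c / b = - c / (2 b)\<close> is critical.\<close>
  have "(t - b) ^ 3 + b * (t - b) ^ 2 + c * (t - b) - (t ^ 3 + b * t ^ 2 + c * t)
      = - (3 * (b * t ^ 2))"
    unfolding t(2) by (simp add: algebra_simps power2_eq_square power3_eq_cube)
  also have "\<dots> = 0" using assms(1) by simp
  finally have "(t - b) ^ 3 + b * (t - b) ^ 2 + c * (t - b) = t ^ 3 + b * t ^ 2 + c * t"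
    by (simp only: right_minus_eq)
  then have "t - b = t"
    by (rule inj_onD[OF inj]) (use t assms(2) in \<open>simp_all add: K_closed\<close>)
  then show False using b by simp
qed

text \<open>Outcomes (2) and (3) together. In characteristic 3 the polynomial
  \<open>X ^ 3 - e * X\<close> is additive, and for nonsquare \<open>e\<close> its only zero in
  \<open>K\<close> is 0.\<close>

definition equiv_cube_or_Dickson :: "('a \<Rightarrow> 'a) \<Rightarrow> bool" where
  "equiv_cube_or_Dickson f \<longleftrightarrow> lin_equiv_pair q f (\<lambda>(x, y). (x ^ 3, y ^ 3)) \<or>
     (q mod 3 = 0 \<and> (\<exists>e\<in>K. e \<noteq> 0 \<and> \<not> (\<exists>y\<in>K. y ^ 2 = e) \<and>
         lin_equiv_pair q f (\<lambda>(x, y). (x ^ 3 - e * x * y ^ 2, y ^ 3))))"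

text \<open>The form \<open>\<gamma> * v ^ 3\<close> in the pencil becomes one target coordinate. On
  the line \<open>v = 1\<close> the other coordinate is a cubic polynomial injective on
  \<open>K\<close>, which can be normalised.\<close>

lemma equiv_of_triple_fibre:
  assumes q: "q \<ge> 3" "q mod 3 \<noteq> 1" and f: "cubic_form f" "bij f"
    and e: "indep e\<^sub>1 e\<^sub>2" and "\<mu> \<noteq> 0"
    and fibre: "\<And>u v. u \<in> K \<Longrightarrow> v \<in> K \<Longrightarrow>
      \<mu> * f (u * e\<^sub>1 + v * e\<^sub>2) + cnj (\<mu> * f (u * e\<^sub>1 + v * e\<^sub>2)) = \<gamma> * v ^ 3"
  shows "equiv_cube_or_Dickson f"
proof -
  have injf: "x = y" if "f x = f y" for x y using f(2) that by (metis bij_pointE)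
  obtain y \<beta>\<^sub>1 \<beta>\<^sub>2 y' where fe: "\<And>u v. u \<in> K \<Longrightarrow> v \<in> K \<Longrightarrow>
      f (u * e\<^sub>1 + v * e\<^sub>2) = y * u ^ 3 + \<beta>\<^sub>1 * (u ^ 2 * v) + \<beta>\<^sub>2 * (u * v ^ 2) + y' * v ^ 3"
    using cubic_form_basis[OF f(1), of e\<^sub>1 e\<^sub>2] by metis
  define tr where "tr x = \<mu> * x + cnj (\<mu> * x)" for x
  have tr: "tr y * u ^ 3 + tr \<beta>\<^sub>1 * (u ^ 2 * v) + tr \<beta>\<^sub>2 * (u * v ^ 2) + tr y' * v ^ 3 = \<gamma> * v ^ 3"
    if "u \<in> K" "v \<in> K" for u v
    using fibre[OF that] fe[OF that] that by (simp add: tr_def K_D algebra_simps)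
  \<comment> \<open>A third element of \<open>K\<close> is needed to separate the coefficients of
    \<open>u ^ 2 * v\<close> and \<open>u * v ^ 2\<close>.\<close>
  have "\<exists>k. k \<in> K \<and> k \<noteq> 0 \<and> k \<noteq> 1"
  proof (rule ccontr)
    assume "\<not> ?thesis"
    then have "K \<subseteq> {0, 1}" by auto
    then have "card K \<le> card {0, 1::'a}" by (intro card_mono) auto
    then show False using q card_K by simp
  qed
  then obtain k where k: "k \<in> K" "k \<noteq> 0" "k \<noteq> 1" by blast
  have y0: "tr y = 0" using tr[of 1 0] by auto
  have y'0: "tr y' = \<gamma>" using tr[of 0 1] by auto
  have *: "tr \<beta>\<^sub>1 + tr \<beta>\<^sub>2 = 0" using tr[of 1 1] y0 y'0 by auto
  have "k * (tr \<beta>\<^sub>1 * k + tr \<beta>\<^sub>2) = 0"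
    using tr[of k 1] k y0 y'0 by (simp add: K_closed algebra_simps power2_eq_square)
  then have "tr \<beta>\<^sub>1 * k + tr \<beta>\<^sub>2 = 0" using k by simp
  moreover have "tr \<beta>\<^sub>1 * (k - 1) = (tr \<beta>\<^sub>1 * k + tr \<beta>\<^sub>2) - (tr \<beta>\<^sub>1 + tr \<beta>\<^sub>2)"
    by (simp add: algebra_simps)
  ultimately have "tr \<beta>\<^sub>1 * (k - 1) = 0" using * by simp
  then have "tr \<beta>\<^sub>1 = 0" using k by simp
  then have "tr \<beta>\<^sub>2 = 0" using * by simp
  have e1: "e\<^sub>1 \<noteq> 0" using e by (auto simp: indep_def)
  have fe1: "f e\<^sub>1 = y" using fe[of 1 0] by auto
  have fe2: "f e\<^sub>2 = y'" using fe[of 0 1] by auto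
  have "y \<noteq> 0" using injf[of e\<^sub>1 0] e1 fe1 f(1) by auto
  \<comment> \<open>The kernel of \<open>tr\<close> is the line \<open>K y\<close>, so
    \<open>\<beta>\<^sub>1\<close> and \<open>\<beta>\<^sub>2\<close> are multiples of
    \<open>y\<close> by elements of \<open>K\<close>.\<close>
  have ratio: "x / y \<in> K" if "tr x = 0" for x
  proof -
    have "cnj \<mu> * cnj x = - (\<mu> * x)" "cnj \<mu> * cnj y = - (\<mu> * y)"
      using that y0 by (simp_all add: tr_def eq_neg_iff_add_eq_0 add.commute)
    then have "(cnj \<mu> * cnj x) / (cnj \<mu> * cnj y) = (\<mu> * x) / (\<mu> * y)" by simp
    then show ?thesis using \<open>\<mu> \<noteq> 0\<close> by (simp add: K_iff)
  qed
  define b c where "b = \<beta>\<^sub>1 / y" and "c = \<beta>\<^sub>2 / y"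
  have bc: "b \<in> K" "c \<in> K"
    using ratio \<open>tr \<beta>\<^sub>1 = 0\<close> \<open>tr \<beta>\<^sub>2 = 0\<close> by (auto simp: b_def c_def)
  have fe': "f (u * e\<^sub>1 + v * e\<^sub>2) = (u ^ 3 + b * (u ^ 2 * v) + c * (u * v ^ 2)) * y + v ^ 3 * y'"
    if "u \<in> K" "v \<in> K" for u v
    using fe[OF that] \<open>y \<noteq> 0\<close> by (simp add: b_def c_def algebra_simps)
  \<comment> \<open>Every element of \<open>K\<close> is a cube, so \<open>y'\<close> in the line
    \<open>K y\<close> would give \<open>e\<^sub>2\<close> the same value as a multiple of
    \<open>e\<^sub>1\<close>.\<close>
  have yy': "indep y y'"
  proof (rule indepI)
    fix m assume "m \<in> K"
    then obtain l where l: "l \<in> K" "l ^ 3 = m" using surj_on_cube_K[OF q(2)] by metis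
    show "y' \<noteq> m * y"
    proof
      assume "y' = m * y"
      then have "f e\<^sub>2 = f (l * e\<^sub>1)" using cubic_form_scale[OF f(1) l(1)] l(2) fe1 fe2 by simp
      then have "(- l) * e\<^sub>1 + 1 * e\<^sub>2 = 0" using injf by fastforce
      then show False using indepD[OF e, of "- l" 1] l(1) by auto
    qed
  qed fact
  have inj: "inj_on (\<lambda>t. t ^ 3 + b * t ^ 2 + c * t) K"
  proof (rule inj_onI)
    fix s t assume st: "s \<in> K" "t \<in> K" "s ^ 3 + b * s ^ 2 + c * s = t ^ 3 + b * t ^ 2 + c * t"
    then have "f (s * e\<^sub>1 + 1 * e\<^sub>2) = f (t * e\<^sub>1 + 1 * e\<^sub>2)"
      using fe'[of s 1] fe'[of t 1] by (simp add: K_closed)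
    then have "s * e\<^sub>1 + 1 * e\<^sub>2 = t * e\<^sub>1 + 1 * e\<^sub>2" by (rule injf)
    then show "s = t" using e1 by simp
  qed
  show ?thesis
  proof (cases "q mod 3 = 0")
    case False
    then have q3: "q mod 3 = 2" using q(2) by linarith
    have three: "(3::'a) \<noteq> 0" using False by (rule not_char_3)
    \<comment> \<open>Completing the cube. The source shift removes the quadratic term; the
      resulting multiple of \<open>v ^ 3\<close> is absorbed into the second target basis
      vector.\<close>
    define \<beta> where "\<beta> = b / 3"
    have \<beta>: "\<beta> \<in> K" "b = 3 * \<beta>" using bc three by (auto simp: \<beta>_def K_closed)
    have shift: "(t - \<beta> * v) ^ 3 + b * ((t - \<beta> * v) ^ 2 * v) + c * ((t - \<beta> * v) * v ^ 2)
        = t ^ 3 + (c - 3 * \<beta> ^ 2) * (t * v ^ 2) + (2 * \<beta> ^ 3 - \<beta> * c) * v ^ 3" for t v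
      unfolding \<beta>(2) by (simp add: algebra_simps power2_eq_square power3_eq_cube)
    have "inj_on (\<lambda>t. t ^ 3 + (c - 3 * \<beta> ^ 2) * t) K"
    proof (rule inj_onI)
      fix s t assume st: "s \<in> K" "t \<in> K"
        "s ^ 3 + (c - 3 * \<beta> ^ 2) * s = t ^ 3 + (c - 3 * \<beta> ^ 2) * t"
      have "(s - \<beta>) ^ 3 + b * (s - \<beta>) ^ 2 + c * (s - \<beta>)
          = (t - \<beta>) ^ 3 + b * (t - \<beta>) ^ 2 + c * (t - \<beta>)"
        using shift[of s 1] shift[of t 1] st(3) by (simp only: mult_1_right power_one)
      then have "s - \<beta> = t - \<beta>"
        by (rule inj_onD[OF inj]) (use st \<beta> in \<open>simp_all add: K_closed\<close>)
      then show "s = t" by simp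
    qed
    then have c0: "c - 3 * \<beta> ^ 2 = 0"
      using \<beta> bc by (intro cubic_perm_linear_coeff[OF q(1) q3]) auto
    have "lin_equiv_pair q f (\<lambda>(x, y). (x ^ 3, y ^ 3))"
    proof (rule lin_equiv_pairI)
      show "indep e\<^sub>1 (e\<^sub>2 + (- \<beta>) * e\<^sub>1)" using e \<beta> by (intro indep_add_scaled) auto
      show "indep y (y' + (2 * \<beta> ^ 3 - \<beta> * c) * y)" using yy' \<beta> bc by (intro indep_add_scaled) auto
      fix u v assume uv: "u \<in> K" "v \<in> K"
      have "u * e\<^sub>1 + v * (e\<^sub>2 + - \<beta> * e\<^sub>1) = (u - \<beta> * v) * e\<^sub>1 + v * e\<^sub>2"
        by (simp add: algebra_simps)
      then have "f (u * e\<^sub>1 + v * (e\<^sub>2 + - \<beta> * e\<^sub>1)) =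
          (u ^ 3 + (2 * \<beta> ^ 3 - \<beta> * c) * v ^ 3) * y + v ^ 3 * y'"
        using fe'[of "u - \<beta> * v" v, unfolded shift c0] uv \<beta>(1) by (simp add: K_closed)
      then show "f (u * e\<^sub>1 + v * (e\<^sub>2 + - \<beta> * e\<^sub>1)) =
          fst (case (u, v) of (x, y) \<Rightarrow> (x ^ 3, y ^ 3)) * y +
          snd (case (u, v) of (x, y) \<Rightarrow> (x ^ 3, y ^ 3)) * (y' + (2 * \<beta> ^ 3 - \<beta> * c) * y)"
        by (simp add: algebra_simps)
    qed
    then show ?thesis by (simp add: equiv_cube_or_Dickson_def)
  next
    case True
    have b0: "b = 0" using cubic_perm_char_3_quadratic_coeff[OF char_3[OF True] bc inj] .
    show ?thesis
    proof (cases "c = 0")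
      case True
      have "lin_equiv_pair q f (\<lambda>(x, y). (x ^ 3, y ^ 3))"
        by (rule lin_equiv_pairI[OF e yy']) (simp add: fe' b0 True)
      then show ?thesis by (simp add: equiv_cube_or_Dickson_def)
    next
      case False
      \<comment> \<open>A square root of \<open>- c\<close> in \<open>K\<close> would be a second
        zero of \<open>t ^ 3 + c * t\<close>; hence \<open>e = - c\<close> is the nonsquare
        wanted.\<close>
      have "\<not> (\<exists>t\<in>K. t ^ 2 = - c)"
      proof
        assume "\<exists>t\<in>K. t ^ 2 = - c"
        then obtain t where t: "t \<in> K" "t ^ 2 = - c" by blast
        have "t ^ 3 + b * t ^ 2 + c * t = t * (t ^ 2 + c)"
          unfolding b0 by (simp add: algebra_simps power2_eq_square power3_eq_cube)
        then have "t ^ 3 + b * t ^ 2 + c * t = 0 ^ 3 + b * 0 ^ 2 + c * 0" using t(2) by simp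
        then have "t = 0"
          by (rule inj_onD[OF inj]) (use t in \<open>simp_all add: K_closed\<close>)
        then show False using t False by simp
      qed
      moreover have "lin_equiv_pair q f (\<lambda>(x, y). (x ^ 3 - (- c) * x * y ^ 2, y ^ 3))"
        by (rule lin_equiv_pairI[OF e yy']) (simp add: fe' b0 mult.assoc)
      ultimately show ?thesis
        using True False bc unfolding equiv_cube_or_Dickson_def
        by (intro disjI2 conjI bexI[of _ "- c"]) auto
    qed
  qed
qed

section \<open>Cubic forms with a fibre of norm type\<close>

text \<open>In characteristic 3 the root is 1; for \<open>q mod 3 = 2\<close> it is a cube root of
  unity, on which conjugation is squaring.\<close>

lemma ex_omega:
  assumes "q mod 3 \<noteq> 1"
  obtains \<omega> where "\<omega> ^ 2 + \<omega> + 1 = 0" "cnj \<omega> = \<omega> ^ 2"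
proof -
  obtain \<omega> :: 'a where \<omega>: "\<omega> ^ 2 + 1 * \<omega> + 1 = 0"
    by (rule quadratic_root_exists[OF K_closed(2) K_closed(2)]) (rule that)
  have "\<omega> ^ 3 - 1 = (\<omega> - 1) * (\<omega> ^ 2 + 1 * \<omega> + 1)"
    by (simp add: algebra_simps power2_eq_square power3_eq_cube)
  then have \<omega>3: "\<omega> ^ 3 = 1" using \<omega> by simp
  have "cnj \<omega> = \<omega> ^ 2"
  proof (cases "q mod 3 = 0")
    case True
    have "(\<omega> - 1) ^ 2 = (\<omega> ^ 2 + 1 * \<omega> + 1) - 3 * \<omega>"
      by (simp add: algebra_simps power2_eq_square)
    then have "\<omega> = 1" using \<omega> char_3[OF True] by simp
    then show ?thesis by simp
  next
    case False
    then show ?thesis using assms \<omega>3 by (intro cube_eq_1_imp_cnj) linarith+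
  qed
  then show ?thesis using that \<omega> by simp
qed

text \<open>The traces of \<open>f\<close> and of \<open>\<theta> * f\<close> are the two coordinate
  forms of \<open>f\<close>. The power sums restrict the second one, and each surviving alternative
  is a normal form.\<close>

lemma equiv_of_norm_fibre:
  assumes q: "q \<ge> 3" "q mod 3 \<noteq> 1" and f: "cubic_form f" "bij f" and \<kappa>: "\<kappa> \<in> K" "\<kappa> \<noteq> 0"
    and fibre: "\<And>x. f x + cnj (f x) = \<kappa> * (x * cnj x * (x + cnj x))"
  shows "lin_equiv_self q f (\<lambda>x. x ^ (q + 2)) \<or> equiv_cube_or_Dickson f"
proof -
  have injf: "x = y" if "f x = f y" for x y using f(2) that by (metis bij_pointE)
  have f_eq_0: "x = 0" if "f x = 0" for x using injf[of x 0] that f(1) by simp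
  obtain \<theta> where \<theta>: "\<theta> \<notin> K" using ex_not_in_K by blast
  then have \<theta>': "\<theta> - cnj \<theta> \<noteq> 0" by (auto simp: K_iff)
  obtain a b c d where
    f': "\<And>x. f x = a * cnj x ^ 3 + b * (cnj x ^ 2 * x) + c * (cnj x * x ^ 2) + d * x ^ 3"
    using f(1) unfolding cubic_form_def by blast
  define r s where "r = \<theta> * d + cnj (\<theta> * a)" and "s = \<theta> * c + cnj (\<theta> * b)"
  define h where
    "h x = r * x ^ 3 + s * (x ^ 2 * cnj x) + cnj s * (x * cnj x ^ 2) + cnj r * cnj x ^ 3" for x
  have h: "h x = \<theta> * f x + cnj (\<theta> * f x)" for x
    unfolding h_def f' r_def s_def by (simp add: algebra_simps)
  have recover: "f x = (h x - cnj \<theta> * (f x + cnj (f x))) / (\<theta> - cnj \<theta>)" for x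
  proof -
    have "f x * (\<theta> - cnj \<theta>) = h x - cnj \<theta> * (f x + cnj (f x))"
      unfolding h by (simp add: algebra_simps)
    then show ?thesis using \<theta>' by (simp add: eq_divide_eq)
  qed
  have bij: "bij_betw (\<lambda>x. (\<kappa> * (x * cnj x * (x + cnj x)), h x)) UNIV (K \<times> K)"
  proof -
    have "inj (\<lambda>x. (f x + cnj (f x), h x))"
      using recover injf by (intro injI) (metis Pair_inject)
    moreover from this have "range (\<lambda>x. (f x + cnj (f x), h x)) = K \<times> K"
      by (intro card_subset_eq)
         (auto simp: h card_image card_cartesian_product card_K card_UNIV power2_eq_square
           simp del: cnj_mult)
    ultimately show ?thesis by (simp add: bij_betw_def fibre)
  qed
  note hermite = power_sums_of_norm_form_pair[OF q(1) \<kappa>(2) bij[unfolded h_def]]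
  note r = hermite(1)
  consider "r = 0" | "(2::'a) = 0" "s + cnj s = 0" | "s - cnj s = 3 * r"
    using hermite(2) by blast
  then show ?thesis
  proof cases
    case 1
    define \<alpha> \<beta> where "\<alpha> = (s - cnj \<theta> * \<kappa>) / (\<theta> - cnj \<theta>)" and "\<beta> = (cnj s - cnj \<theta> * \<kappa>) / (\<theta> - cnj \<theta>)"
    have fx: "f x = x * cnj x * (\<alpha> * x + \<beta> * cnj x)" for x
    proof -
      have "h x - cnj \<theta> * (f x + cnj (f x))
          = x * cnj x * ((s - cnj \<theta> * \<kappa>) * x + (cnj s - cnj \<theta> * \<kappa>) * cnj x)"
        unfolding h_def fibre 1 by (simp add: algebra_simps power2_eq_square)
      then have "f x = x * cnj x * (((s - cnj \<theta> * \<kappa>) * x + (cnj s - cnj \<theta> * \<kappa>) * cnj x) / (\<theta> - cnj \<theta>))"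
        by (subst recover) (simp only: times_divide_eq_right)
      also have "((s - cnj \<theta> * \<kappa>) * x + (cnj s - cnj \<theta> * \<kappa>) * cnj x) / (\<theta> - cnj \<theta>) = \<alpha> * x + \<beta> * cnj x"
        by (simp add: \<alpha>_def \<beta>_def add_divide_distrib)
      finally show ?thesis .
    qed
    have "Fq_lin_iso q (\<lambda>x. \<alpha> * x + \<beta> * cnj x)"
      by (rule Fq_lin_isoI, rule f_eq_0) (simp add: fx)
    moreover have "Fq_lin_iso q (\<lambda>x::'a. 1 * x + 0 * cnj x)"
      by (rule Fq_lin_isoI) simp
    \<comment> \<open>The norm \<open>x * cnj x\<close> lies in \<open>K\<close>, so it can be moved
      inside the linear factor, where it turns \<open>x\<close> into
      \<open>x ^ (q + 2)\<close>.\<close>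
    moreover have "f (1 * x + 0 * cnj x) = \<alpha> * x ^ (q + 2) + \<beta> * cnj (x ^ (q + 2))" for x
    proof -
      have pow: "x ^ (q + 2) = cnj x * x ^ 2" by (simp add: cnj_def power_add power2_eq_square)
      show ?thesis unfolding pow by (simp add: fx algebra_simps power2_eq_square)
    qed
    ultimately show ?thesis unfolding lin_equiv_self_iff by blast
  next
    case 2
    \<comment> \<open>The extra alternative of characteristic 2 is impossible: both forms would
      vanish at 1.\<close>
    have "h 1 = (r + cnj r) + (s + cnj s)" by (simp add: h_def)
    also have "\<dots> = 0" using r 2 by simp
    finally have "h 1 = 0" .
    moreover have "f 1 + cnj (f 1) = 0" using fibre[of 1] 2 by simp
    ultimately have "f 1 = 0" using recover[of 1] by simp
    then show ?thesis using f_eq_0[of 1] by simp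
  next
    case 3
    obtain \<omega> where \<omega>: "\<omega> ^ 2 + \<omega> + 1 = 0" "cnj \<omega> = \<omega> ^ 2" using ex_omega[OF q(2)] by blast
    have "\<omega> \<noteq> 0" using \<omega> by auto
    have \<omega>2: "\<omega> ^ 2 = - \<omega> - 1" using \<omega>(1) by (simp add: eq_diff_eq eq_neg_iff_add_eq_0 ac_simps)
    have "\<omega> * \<omega> ^ 2 = 1 + (\<omega> - 1) * (\<omega> ^ 2 + \<omega> + 1)"
      by (simp add: algebra_simps power2_eq_square)
    then have \<omega>3: "\<omega> * \<omega> ^ 2 = 1" unfolding \<omega>(1) by simp
    \<comment> \<open>Chosen by comparing coefficients of \<open>x * cnj x ^ 2\<close>, so that
      \<open>h\<close> plus \<open>\<nu>\<close> times the trace form is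
      \<open>r * (x - \<omega> * cnj x) ^ 3\<close>.\<close>
    define \<nu> where "\<nu> = (3 * r * \<omega> ^ 2 - cnj s) / \<kappa>"
    have s: "s = cnj s + 3 * r" using 3 by (simp add: algebra_simps)
    have "cnj (3 * r * \<omega> ^ 2 - cnj s) = 3 * r * \<omega> ^ 2 - cnj s"
    proof -
      have "cnj (3 * r * \<omega> ^ 2 - cnj s) = - 3 * r * (\<omega> ^ 2) ^ 2 - s"
        by (simp add: \<omega> r)
      also have "(\<omega> ^ 2) ^ 2 = \<omega> * (\<omega> * \<omega> ^ 2)" by (simp add: power2_eq_square)
      also have "\<dots> = \<omega>" using \<omega>3 by simp
      also have "- 3 * r * \<omega> - s = 3 * r * (- \<omega> - 1) - cnj s"
        using s by (simp add: algebra_simps)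
      finally show ?thesis by (simp only: \<omega>2)
    qed
    then have \<nu>: "\<nu> \<in> K" using \<kappa> by (simp add: K_iff \<nu>_def)
    have tr: "(\<theta> + \<nu>) * f x + cnj ((\<theta> + \<nu>) * f x) = r * (x - \<omega> * cnj x) ^ 3" for x
    proof -
      have "(\<theta> + \<nu>) * f x + cnj ((\<theta> + \<nu>) * f x) = h x + \<nu> * (f x + cnj (f x))"
        using \<nu> by (simp add: h K_D algebra_simps)
      also have "\<dots> = h x + (3 * r * \<omega> ^ 2 - cnj s) * (x * cnj x * (x + cnj x))"
        unfolding fibre using \<kappa> by (simp add: \<nu>_def)
      also have "\<dots> = r * (x ^ 3 - cnj x ^ 3 + 3 * (1 + \<omega> ^ 2) * (x ^ 2 * cnj x) + 3 * \<omega> ^ 2 * (x * cnj x ^ 2))"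
        unfolding h_def r by (subst (1) s) (simp add: algebra_simps power2_eq_square power3_eq_cube)
      also have "1 + \<omega> ^ 2 = - \<omega>" using \<omega>2 by simp
      also have "r * (x ^ 3 - cnj x ^ 3 + 3 * - \<omega> * (x ^ 2 * cnj x) + 3 * \<omega> ^ 2 * (x * cnj x ^ 2))
          = r * (x ^ 3 - (\<omega> * \<omega> ^ 2) * cnj x ^ 3 + 3 * - \<omega> * (x ^ 2 * cnj x) + 3 * \<omega> ^ 2 * (x * cnj x ^ 2))"
        by (simp only: \<omega>3 mult_1)
      also have "\<dots> = r * (x - \<omega> * cnj x) ^ 3"
        by (simp add: algebra_simps power2_eq_square power3_eq_cube)
      finally show ?thesis .
    qed
    \<comment> \<open>A nonzero solution of \<open>x = \<omega> * cnj x\<close>, so that in the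
      basis \<open>e\<^sub>1\<close>, \<open>e\<^sub>2\<close> the linear form is a constant times
      \<open>v\<close>.\<close>
    define e\<^sub>1 where "e\<^sub>1 = - (\<omega> ^ 2)"
    define e\<^sub>2 where "e\<^sub>2 = \<theta> * e\<^sub>1"
    have e1: "e\<^sub>1 \<noteq> 0" using \<open>\<omega> \<noteq> 0\<close> by (simp add: e\<^sub>1_def)
    have ker: "e\<^sub>1 - \<omega> * cnj e\<^sub>1 = 0"
    proof -
      have "\<omega> * cnj e\<^sub>1 = - ((\<omega> * \<omega> ^ 2) * \<omega> ^ 2)"
        by (simp add: e\<^sub>1_def \<omega>(2) power2_eq_square mult.assoc)
      then show ?thesis by (simp add: e\<^sub>1_def \<omega>3)
    qed
    have "indep e\<^sub>1 e\<^sub>2"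
      using e1 \<theta> by (intro indepI) (auto simp: e\<^sub>2_def)
    moreover have "\<theta> + \<nu> \<noteq> 0"
    proof
      assume "\<theta> + \<nu> = 0"
      then have "\<theta> = - \<nu>" by (simp add: eq_neg_iff_add_eq_0)
      then show False using \<theta> \<nu> by auto
    qed
    moreover have "(\<theta> + \<nu>) * f (u * e\<^sub>1 + v * e\<^sub>2) + cnj ((\<theta> + \<nu>) * f (u * e\<^sub>1 + v * e\<^sub>2))
        = (r * (e\<^sub>2 - \<omega> * cnj e\<^sub>2) ^ 3) * v ^ 3" if "u \<in> K" "v \<in> K" for u v
    proof -
      have "u * e\<^sub>1 + v * e\<^sub>2 - \<omega> * cnj (u * e\<^sub>1 + v * e\<^sub>2)
          = u * (e\<^sub>1 - \<omega> * cnj e\<^sub>1) + (e\<^sub>2 - \<omega> * cnj e\<^sub>2) * v"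
        using that by (simp add: K_D algebra_simps)
      then show ?thesis unfolding tr ker by (simp add: power_mult_distrib mult.assoc)
    qed
    ultimately have "equiv_cube_or_Dickson f"
      by (intro equiv_of_triple_fibre[OF q f])
    then show ?thesis ..
  qed
qed

text \<open>The form examined is the trace of \<open>f\<close>. Its zeros form a single line,
  because the trace-zero values of \<open>f\<close> are the cubes in \<open>K\<close> times one
  value \<open>y\<close>. Splitting off that line leaves a binary quadratic form.\<close>

lemma equiv_of_bij_cubic_form:
  assumes q: "q \<ge> 3" "q mod 3 \<noteq> 1" and f: "cubic_form f" "bij f"
  shows "lin_equiv_self q f (\<lambda>x. x ^ (q + 2)) \<or> equiv_cube_or_Dickson f"
proof -
  have injf: "x = y" if "f x = f y" for x y using f(2) that by (metis bij_pointE)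
  obtain \<theta> where \<theta>: "\<theta> \<notin> K" using ex_not_in_K by blast
  define y where "y = \<theta> - cnj \<theta>"
  have y: "y \<noteq> 0" "cnj y = - y" using \<theta> by (auto simp: K_iff y_def)
  obtain e\<^sub>1 where e1: "f e\<^sub>1 = y" using f(2) by (metis bij_pointE)
  define e\<^sub>2 where "e\<^sub>2 = \<theta> * e\<^sub>1"
  have "e\<^sub>1 \<noteq> 0" using e1 y f(1) by auto
  then have e: "indep e\<^sub>1 e\<^sub>2" using \<theta> by (intro indepI) (auto simp: e\<^sub>2_def)
  obtain \<beta>\<^sub>0 \<beta>\<^sub>1 \<beta>\<^sub>2 \<beta>\<^sub>3 where fe: "\<And>u v. u \<in> K \<Longrightarrow> v \<in> K \<Longrightarrow> f (u * e\<^sub>1 + v * e\<^sub>2) =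
      \<beta>\<^sub>0 * u ^ 3 + \<beta>\<^sub>1 * (u ^ 2 * v) + \<beta>\<^sub>2 * (u * v ^ 2) + \<beta>\<^sub>3 * v ^ 3"
    using cubic_form_basis[OF f(1), of e\<^sub>1 e\<^sub>2] by metis
  have "f e\<^sub>1 = \<beta>\<^sub>0" using fe[of 1 0] by auto
  then have \<beta>0: "\<beta>\<^sub>0 + cnj \<beta>\<^sub>0 = 0" using e1 y by simp
  define a b c where "a = \<beta>\<^sub>1 + cnj \<beta>\<^sub>1" and "b = \<beta>\<^sub>2 + cnj \<beta>\<^sub>2" and "c = \<beta>\<^sub>3 + cnj \<beta>\<^sub>3"
  have abc: "a \<in> K" "b \<in> K" "c \<in> K" by (auto simp: a_def b_def c_def)
  have tr: "f (u * e\<^sub>1 + v * e\<^sub>2) + cnj (f (u * e\<^sub>1 + v * e\<^sub>2)) = v * (a * u ^ 2 + b * u * v + c * v ^ 2)"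
    if "u \<in> K" "v \<in> K" for u v
  proof -
    have "f (u * e\<^sub>1 + v * e\<^sub>2) + cnj (f (u * e\<^sub>1 + v * e\<^sub>2)) =
      (\<beta>\<^sub>0 + cnj \<beta>\<^sub>0) * u ^ 3 + v * (a * u ^ 2 + b * u * v + c * v ^ 2)"
      unfolding fe[OF that] a_def b_def c_def
      using that by (simp add: K_D algebra_simps power2_eq_square power3_eq_cube)
    then show ?thesis using \<beta>0 by simp
  qed
  have only_zero: "v = 0" if "u \<in> K" "v \<in> K" "v * (a * u ^ 2 + b * u * v + c * v ^ 2) = 0" for u v
  proof -
    let ?x = "u * e\<^sub>1 + v * e\<^sub>2"
    have "cnj (f ?x) = - f ?x" using tr[OF that(1,2)] that(3) by (simp add: eq_neg_iff_add_eq_0 add.commute)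
    then have "f ?x / y \<in> K" using y by (simp add: K_iff)
    then obtain l where l: "l \<in> K" "l ^ 3 = f ?x / y" using surj_on_cube_K[OF q(2)] by metis
    then have "f ?x = f (l * e\<^sub>1)" using cubic_form_scale[OF f(1) l(1)] e1 y by simp
    then have "?x = l * e\<^sub>1" by (rule injf)
    then have "(u - l) * e\<^sub>1 + v * e\<^sub>2 = 0" by (simp add: algebra_simps)
    then show ?thesis using indepD[OF e, of "u - l" v] that l by auto
  qed
  show ?thesis
  proof (cases "a = 0")
    case True
    \<comment> \<open>Otherwise \<open>(- c / b, 1)\<close> would be a zero off the line
      \<open>v = 0\<close>; so the trace form is \<open>c * v ^ 3\<close>.\<close>
    have "b = 0"
    proof (rule ccontr)
      assume "b \<noteq> 0"
      then show False using only_zero[of "- c / b" 1] abc True by (auto simp: K_closed)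
    qed
    then have "equiv_cube_or_Dickson f"
      using tr True
      by (intro equiv_of_triple_fibre[OF q f e, of 1 c])
         (simp_all add: power2_eq_square power3_eq_cube ac_simps)
    then show ?thesis ..
  next
    case False
    obtain z where z: "z ^ 2 + (b / a) * z + (c / a) = 0"
      using quadratic_root_exists[of "b / a" "c / a"] abc by blast
    have "z \<notin> K"
    proof
      assume "z \<in> K"
      moreover have "a * z ^ 2 + b * z + c = a * (z ^ 2 + (b / a) * z + (c / a))"
        using False by (simp add: field_simps)
      ultimately show False using only_zero[of z 1] z by (auto simp: K_closed)
    qed
    define \<epsilon> where "\<epsilon> = cnj z - z"
    have \<epsilon>: "\<epsilon> \<noteq> 0" "cnj \<epsilon> = - \<epsilon>" using \<open>z \<notin> K\<close> by (auto simp: K_iff \<epsilon>_def)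
    have z': "cnj z ^ 2 + (b / a) * cnj z + (c / a) = 0"
      using arg_cong[OF z, of cnj] abc by (simp add: K_D)
    have "\<epsilon> * (cnj z + z + b / a) = (cnj z ^ 2 + (b / a) * cnj z + (c / a)) - (z ^ 2 + (b / a) * z + (c / a))"
      unfolding \<epsilon>_def by (simp add: algebra_simps power2_eq_square)
    also have "\<dots> = 0" by (simp only: z z' diff_self)
    finally have zsum: "cnj z + z + b / a = 0" using \<epsilon>(1) by (simp only: mult_eq_0_iff) simp
    have "z * cnj z - c / a = z * (cnj z + z + b / a) - (z ^ 2 + (b / a) * z + (c / a))"
      by (simp add: algebra_simps power2_eq_square)
    also have "\<dots> = 0" by (simp only: z zsum mult_zero_right diff_self)
    finally have zprod: "z * cnj z - c / a = 0" .
    have factor: "a * u ^ 2 + b * u * v + c * v ^ 2 = a * ((u - z * v) * (u - cnj z * v))" for u v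
    proof -
      have "a * ((u - z * v) * (u - cnj z * v)) - (a * u ^ 2 + b * u * v + c * v ^ 2)
          = - (a * u * v) * (cnj z + z + b / a) + a * v ^ 2 * (z * cnj z - c / a)"
        using False by (simp add: algebra_simps power2_eq_square)
      then show ?thesis unfolding zsum zprod by simp
    qed
    \<comment> \<open>The solution of \<open>u - z * v = x / \<epsilon>\<close> and
      \<open>u - cnj z * v = - cnj x / \<epsilon>\<close>. In this coordinate the quadratic factor
      is a multiple of \<open>x * cnj x\<close>, and \<open>v\<close> is a multiple of
      \<open>x + cnj x\<close>.\<close>
    define v where "v x = (x + cnj x) / \<epsilon> ^ 2" for x
    define u where "u x = x / \<epsilon> + z * v x" for x
    have v: "v x \<in> K" for x by (simp add: v_def K_iff \<epsilon> add.commute)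
    have cu: "cnj (u x) = - cnj x / \<epsilon> + cnj z * v x" for x
      using v[of x] by (simp add: u_def \<epsilon> K_D)
    have u: "u x \<in> K" for x
    proof -
      have "u x - cnj (u x) = (x + cnj x) / \<epsilon> - \<epsilon> * v x"
        unfolding cu by (simp add: u_def \<epsilon>_def algebra_simps add_divide_distrib)
      also have "\<dots> = 0" using \<epsilon>(1) by (simp add: v_def power2_eq_square)
      finally show ?thesis by (simp add: K_iff)
    qed
    define \<alpha> \<beta> where "\<alpha> = e\<^sub>1 / \<epsilon> + (z * e\<^sub>1 + e\<^sub>2) / \<epsilon> ^ 2" and "\<beta> = (z * e\<^sub>1 + e\<^sub>2) / \<epsilon> ^ 2"
    have \<eta>: "\<alpha> * x + \<beta> * cnj x = u x * e\<^sub>1 + v x * e\<^sub>2" for x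
      using \<epsilon>(1) by (simp add: \<alpha>_def \<beta>_def u_def v_def field_simps)
    have iso: "Fq_lin_iso q (\<lambda>x. \<alpha> * x + \<beta> * cnj x)"
    proof (rule Fq_lin_isoI)
      fix x assume "\<alpha> * x + \<beta> * cnj x = 0"
      then have "u x = 0 \<and> v x = 0" unfolding \<eta> using indepD[OF e u v] by simp
      then have "x / \<epsilon> + z * 0 = 0" unfolding u_def by metis
      then show "x = 0" using \<epsilon>(1) by simp
    qed
    define f' where "f' x = f (\<alpha> * x + \<beta> * cnj x)" for x
    have "cubic_form f'" unfolding f'_def using f(1) by (rule cubic_form_comp_linear)
    moreover have "bij f'"
      using iso f(2) unfolding f'_def Fq_lin_iso_def by (auto intro: bij_comp[unfolded comp_def])
    moreover have "f' x + cnj (f' x) = (- a / \<epsilon> ^ 4) * (x * cnj x * (x + cnj x))" for x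
    proof -
      have "u x - z * v x = x / \<epsilon>" by (simp add: u_def)
      moreover have "u x - cnj z * v x = - cnj x / \<epsilon>"
        using cu[of x] u[of x] by (simp add: K_D)
      ultimately have "f' x + cnj (f' x) = v x * (a * ((x / \<epsilon>) * (- cnj x / \<epsilon>)))"
        unfolding f'_def \<eta> tr[OF u v] factor by simp
      then show ?thesis
        by (simp add: v_def power2_eq_square eval_nat_numeral ac_simps)
    qed
    moreover have "- a / \<epsilon> ^ 4 \<in> K" using abc by (simp add: K_iff \<epsilon>)
    ultimately have "lin_equiv_self q f' (\<lambda>x. x ^ (q + 2)) \<or> equiv_cube_or_Dickson f'"
      using False \<epsilon>(1) by (intro equiv_of_norm_fibre[OF q, of f' "- a / \<epsilon> ^ 4"]) auto
    then show ?thesis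
      unfolding f'_def equiv_cube_or_Dickson_def
      using lin_equiv_self_comp[OF iso] lin_equiv_pair_comp[OF iso] by blast
  qed
qed

end

section \<open>Bijectivity and the three normal forms\<close>

theorem theorem1p10:
  fixes q :: nat and a b c d :: "'a::{field,finite}"
  assumes "\<exists>p k. prime p \<and> k > 0 \<and> q = p ^ k"
    and "card (UNIV :: 'a set) = q ^ 2"
  defines "f \<equiv> (\<lambda>x::'a. a * x ^ (3 * q) + b * x ^ (2 * q + 1) + c * x ^ (q + 2) + d * x ^ 3)"
  shows "bij f \<longleftrightarrow>
     (q mod 3 \<noteq> 1 \<and> lin_equiv_self q f (\<lambda>x. x ^ (q + 2)))
   \<or> (q mod 3 \<noteq> 1 \<and> lin_equiv_pair q f (\<lambda>(x, y). (x ^ 3, y ^ 3)))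
   \<or> (q mod 3 = 0 \<and> (\<exists>e\<in>Fq q. e \<noteq> 0 \<and> \<not> (\<exists>y\<in>Fq q. y ^ 2 = e) \<and>
         lin_equiv_pair q f (\<lambda>(x, y). (x ^ 3 - e * x * y ^ 2, y ^ 3))))"
    (is "_ \<longleftrightarrow> ?rhs")
proof -
  interpret quadratic_extension q "TYPE('a)"
    using assms(1,2) by unfold_locales
  have fx: "f x = a * cnj x ^ 3 + b * (cnj x ^ 2 * x) + c * (cnj x * x ^ 2) + d * x ^ 3" for x
    by (simp add: f_def cnj_def power_add mult.commute[of _ q] power_mult power2_eq_square)
  then have cubic: "cubic_form f" unfolding cubic_form_def by blast
  show ?thesis
  proof
    assume bij: "bij f"
    have q3: "q mod 3 \<noteq> 1"
    proof
      assume "q mod 3 = 1"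
      then obtain w where w: "w \<in> K" "w \<noteq> 1" "w ^ 3 = 1" by (rule ex_cube_root_of_unity)
      \<comment> \<open>Homogeneity of degree 3 makes \<open>w\<close> and 1 collide.\<close>
      have "f (w * 1) = f 1" using cubic_form_scale[OF cubic w(1), of 1] w by simp
      then show False using bij w by (metis bij_pointE mult_1_right)
    qed
    show ?rhs
    \<comment> \<open>For \<open>q = 2\<close> the general argument lacks a third element of
      \<open>K\<close>. On four elements a vanishing power sum removes the cubic term; what remains
      is linear, and \<open>x ^ (q + 2)\<close> is the identity.\<close>
    proof (cases "q = 2")
      case True
      have x4: "x ^ 4 = x" for x :: 'a
        using finite_field_power_card[of x] assms(2) True by simp
      have x6: "x ^ 6 = x ^ 3" for x :: 'a
        using power_add[of x 4 2] power_add[of x 1 2] by (simp add: x4 power2_eq_square power3_eq_cube)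
      have x5: "x ^ 5 = x ^ 2" for x :: 'a
        using power_add[of x 4 1] by (simp add: x4 power2_eq_square)
      have f2: "f x = (a + d) * x ^ 3 + b * x ^ 2 + c * x ^ 1" for x
        by (simp add: f_def True x4 x5 x6 algebra_simps)
      have "(\<Sum>x\<in>UNIV. f x) = (\<Sum>x\<in>UNIV. x ^ 1)"
        using sum.reindex_bij_betw[of f UNIV UNIV "\<lambda>x. x"] bij by simp
      also have "\<dots> = 0" using sum_power_UNIV[of 1] True by simp
      finally have "0 = (\<Sum>x\<in>UNIV. f x)" ..
      also have "\<dots> = (a + d) * (\<Sum>x\<in>UNIV. x ^ 3) + b * (\<Sum>x\<in>UNIV. x ^ 2) + c * (\<Sum>x\<in>UNIV. x ^ 1)"
        unfolding f2 by (simp only: sum.distrib sum_distrib_left)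
      also have "\<dots> = - (a + d)"
        using sum_power_UNIV[of 3] sum_power_UNIV[of 2] sum_power_UNIV[of 1] True by simp
      finally have ad: "a + d = 0" by (simp only: neg_0_equal_iff_equal)
      have lin: "f x = c * x + b * cnj x" for x
        unfolding f2 ad cnj_def unfolding True by simp
      have "Fq_lin_iso q (\<lambda>x. c * x + b * cnj x)"
        using bij lin by (intro Fq_lin_isoI) (metis bij_pointE cubic cubic_form_0)
      moreover have "Fq_lin_iso q (\<lambda>x::'a. 1 * x + 0 * cnj x)"
        by (rule Fq_lin_isoI) simp
      moreover have "f (1 * x + 0 * cnj x) = c * x ^ (q + 2) + b * cnj (x ^ (q + 2))" for x
      proof -
        have pow: "x ^ (q + 2) = x" by (simp add: True x4)
        show ?thesis unfolding pow by (simp add: lin)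
      qed
      ultimately have "lin_equiv_self q f (\<lambda>x. x ^ (q + 2))"
        unfolding lin_equiv_self_iff by blast
      then show ?thesis using q3 by blast
    next
      case False
      then have "q \<ge> 3" using q_ge_2 by simp
      then show ?thesis
        using equiv_of_bij_cubic_form[OF _ q3 cubic bij] q3
        unfolding equiv_cube_or_Dickson_def by blast
    qed
  next
    assume ?rhs
    then show "bij f"
    proof (elim disjE conjE bexE)
      assume 1: "q mod 3 \<noteq> 1" "lin_equiv_self q f (\<lambda>x. x ^ (q + 2))"
      from 1(2) obtain \<rho> \<eta> :: "'a \<Rightarrow> 'a" where *: "bij \<rho>" "bij \<eta>" "\<forall>u. f u = \<rho> ((inv \<eta> u) ^ (q + 2))"
        unfolding lin_equiv_self_def Fq_lin_iso_def by blast
      then have "f = \<rho> \<circ> (\<lambda>x. x ^ (q + 2)) \<circ> inv \<eta>" by (auto simp: fun_eq_iff)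
      then show ?thesis
        using * bij_power_q_plus_2[OF 1(1)] by (simp add: bij_comp bij_imp_bij_inv)
    next
      assume 2: "q mod 3 \<noteq> 1" "lin_equiv_pair q f (\<lambda>(x, y). (x ^ 3, y ^ 3))"
      note cube = inj_onD[OF inj_on_cube_K[OF 2(1)]]
      show ?thesis
        by (rule lin_equiv_pair_imp_bij[OF 2(2)]) (auto simp: inj_on_def intro: cube)
    next
      fix e
      assume 3: "q mod 3 = 0" "e \<in> K" "\<not> (\<exists>y\<in>K. y ^ 2 = e)"
         "lin_equiv_pair q f (\<lambda>(x, y). (x ^ 3 - e * x * y ^ 2, y ^ 3))"
      note cube = inj_onD[OF inj_on_cube_K]
      have three: "(3::'a) = 0" using 3(1) by (rule char_3)
      have "inj_on (\<lambda>(x, y). (x ^ 3 - e * x * y ^ 2, y ^ 3)) (K \<times> K)"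
      proof (rule inj_onI; clarify)
        fix x y x' y' assume K: "x \<in> K" "y \<in> K" "x' \<in> K" "y' \<in> K"
          and eq: "x ^ 3 - e * x * y ^ 2 = x' ^ 3 - e * x' * y' ^ 2" "y ^ 3 = y' ^ 3"
        have yy: "y = y'" using cube[OF _ eq(2)] K 3(1) by simp
        \<comment> \<open>Additivity of cubing turns a collision into an equation for the
          difference; a nonzero difference would make \<open>e\<close> a square.\<close>
        have "(x - x') ^ 3 = e * (x - x') * y ^ 2"
          using eq(1) unfolding yy char_3_cube_diff[OF three] by (simp add: algebra_simps)
        then have *: "(x - x') * ((x - x') ^ 2 - e * y ^ 2) = 0"
          by (simp add: algebra_simps power2_eq_square power3_eq_cube)
        have "x = x'"
        proof (rule ccontr)
          assume "x \<noteq> x'"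
          then have **: "(x - x') ^ 2 = e * y ^ 2" using * by simp
          then have "y \<noteq> 0" using \<open>x \<noteq> x'\<close> by auto
          then have "((x - x') / y) ^ 2 = e" using ** by (simp add: power_divide)
          moreover have "(x - x') / y \<in> K" using K by auto
          ultimately show False using 3(3) by blast
        qed
        then show "x = x' \<and> y = y'" using yy by simp
      qed
      then show ?thesis
        using 3(2) by (intro lin_equiv_pair_imp_bij[OF 3(4)]) auto
    qed
  qed
qed

end
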